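(* Suppose the generator $\mathcal{L}$ is in linear hypocoercive form, i.e. $\mathcal{L}=B-A^*A$, so that the modified Kolmogorov equation for $h_t=\rho_t/\mu$ reads $\partial_t h_t=-(B+A^*A)h_t$, and suppose that both $B$ and $B'$ obey the chain and product rule. Then the Fokker-Planck equation $\partial_t\rho_t=\mathcal{L}'\rho_t$ for $\rho_t=h_t\mu$ is in (generalised) Wasserstein pre-GENERIC form with entropy functional given by the relative entropy $\mathcal{S}_\mu(\rho)=\int_{\mathbb{R}^d}\log\left(\frac{\rho(x)}{\mu(x)}\right)\rho(x)\,dx$ and with $$M_\rho(\xi)=2A'(\rho\,A\xi),\qquad W(\rho)=-B\rho .$$ That is, $$\partial_t\rho_t=W(\rho_t)-M_{\rho_t}\left(\tfrac12\,\mathbf{d}\mathcal{S}_\mu(\rho_t)\right),$$ for every $\rho\in\mathcal{V}$ with $\rho>0$ the operator $M_\rho$ is symmetric and positive semidefinite with respect to $(\cdot,\cdot)$, and the degeneracy condition $(W(\rho),\mathbf{d}\mathcal{S}_\mu(\rho))=0$ holds for all $\rho\in\mathcal{V}$.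
   Context: Setting. $\{X_t\}_{t\ge0}$ is a time-homogeneous Markov process on $\mathbb{R}^d$ with generator (Kolmogorov operator) $\mathcal{L}$. A prime $'$ denotes the formal adjoint in $L^2(\mathbb{R}^d)$, a star $^*$ the adjoint in $L^2_\mu:=\{f:\int f^2\mu\,dx<\infty\}$; $(f,g)=\int_{\mathbb{R}^d} fg\,dx$ denotes the $L^2$ scalar product (acting possibly only as a formal duality pairing). The Fokker-Planck equation is $\partial_t\rho_t=\mathcal{L}'\rho_t$. Standing assumptions: (1) all probability measures have a Lebesgue density, denoted by the same letter; (2) $X_t$ admits a unique invariant measure $\mu$, with smooth enough density, $\mu(x)>0$ for all $x$, so that $\mathcal{L}'\mu=0$ and (by ergodicity) the kernel of the linear operator $\mathcal{L}$ in $L^2_\mu$ consists exactly of the constants; (3) the Fokker-Planck equation admits strictly positive classical solutions belonging to $L^2(\mathbb{R}^d)\cap L^1(\mathbb{R}^d)$; (4) $\mathcal{L}$ generates a strongly continuous contraction semigroup on $L^2_\mu$. $\mathcal{D}_2(\cdot)$ denotes the domain in $L^2_\mu$. $\mathcal{V}$ is a fixed set of functions, dense both in $\mathcal{D}_2(\mathcal{L})\cap\mathcal{D}_2(\mathcal{L}^* )$ and in the set of positive classical solutions of the Fokker-Planck equation lying in $L^2\cap L^1$, on which all operators are assumed to act and on which all calculations are performed (in practice $\mathcal{V}$ can often be taken to be the (positive) Schwartz functions). Linear hypocoercive form: $\mathcal{L}$ is linear and $\mathcal{L}=B-A^*A$, where $A:\mathcal{V}\to(L^2_\mu)^d$ and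 $B:\mathcal{V}\to L^2_\mu$ are linear, $A=(A_1,\dots,A_d)$ obeys the chain rule, $A^*A:=\sum_i A_i^*A_i$, $B$ is antisymmetric in $L^2_\mu$ ($B^*=-B$) and obeys the chain and product rule. (Product rule: $T(fg)=fTg+gTf$; chain rule: $T(\varphi(f))=\varphi'(f)Tf$ for smooth $\varphi$.) For a functional $\mathcal{S}$, $\mathbf{d}\mathcal{S}(\rho)$ is its Fréchet derivative: $(\mathbf{d}\mathcal{S}(\rho),g)=\frac{d}{d\epsilon}\mathcal{S}(\rho+\epsilon g)|_{\epsilon=0}$; in particular $\mathbf{d}\mathcal{S}_\mu(\rho)=\log(\rho/\mu)+1$. An equation $\partial_t\rho_t=W(\rho_t)-M_{\rho_t}(\frac12\mathbf{d}\mathcal{S}(\rho_t))$ is quadratic pre-GENERIC if $M_\rho$ is symmetric and positive semidefinite w.r.t. $(\cdot,\cdot)$ for each $\rho\in\mathcal{V}$, $\rho>0$, and $(W(\rho),\mathbf{d}\mathcal{S}(\rho))=0$ for all $\rho\in\mathcal{V}$; it is generalised Wasserstein pre-GENERIC if in addition $M_\rho(\cdot)=2A'(\rho A(\cdot))$ for some operator $A$ with $L^2$-dual $A'$. *)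

theory Defs
  imports "HOL-Probability.Probability"
begin

type_synonym 'n fn = "real^'n \<Rightarrow> real"
type_synonym 'n opr = "'n fn \<Rightarrow> 'n fn"

section \<open>Weighted \<open>L\<^sup>2\<close> spaces\<close>

text \<open>The weight \<open>\<lambda>_. 1\<close> gives \<open>L\<^sup>2(\<real>\<^sup>d)\<close>, the weight \<open>\<mu>\<close> gives \<open>L\<^sup>2\<^sub>\<mu>\<close>.
  Elements are functions, not classes modulo null sets.\<close>

definition inner_w :: "'n::finite fn \<Rightarrow> 'n fn \<Rightarrow> 'n fn \<Rightarrow> real" where
  "inner_w w f g = (\<integral>x. f x * g x * w x \<partial>lborel)"

definition pairable :: "'n::finite fn \<Rightarrow> 'n fn \<Rightarrow> 'n fn \<Rightarrow> bool" where
  "pairable w f g \<longleftrightarrow> integrable lborel (\<lambda>x. f x * g x * w x)"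

definition L2 :: "'n::finite fn \<Rightarrow> 'n fn set" where
  "L2 w = {f \<in> borel_measurable borel. integrable lborel (\<lambda>x. (f x)\<^sup>2 * w x)}"

definition norm2 :: "'n::finite fn \<Rightarrow> 'n fn \<Rightarrow> real" where
  "norm2 w f = sqrt (inner_w w f f)"

section \<open>Smooth functions\<close>

fun Ck :: "nat \<Rightarrow> 'n::finite fn \<Rightarrow> bool" where
  "Ck 0 f \<longleftrightarrow> continuous_on UNIV f"
| "Ck (Suc k) f \<longleftrightarrow> (\<forall>x. f differentiable (at x)) \<and>
     (\<forall>i. Ck k (\<lambda>x. frechet_derivative f (at x) (axis i 1)))"

definition compactly_supported :: "'n::finite fn \<Rightarrow> bool" where
  "compactly_supported f \<longleftrightarrow> compact (closure {x. f x \<noteq> 0})"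

definition test_functions :: "'n::finite fn set" where
  "test_functions = {f. (\<forall>k. Ck k f) \<and> compactly_supported f}"

definition smooth_real_on :: "real set \<Rightarrow> (real \<Rightarrow> real) \<Rightarrow> bool" where
  "smooth_real_on I \<phi> \<longleftrightarrow> (\<forall>k. \<forall>y\<in>I. (deriv ^^ k) \<phi> field_differentiable (at y))"

section \<open>Operators\<close>

text \<open>The computations apply the operators not only to \<open>\<V>\<close>, but also to constants, to \<open>\<mu>\<close>,
  to \<open>\<rho> / \<mu>\<close>, to \<open>log (\<rho> / \<mu>)\<close> and to \<open>\<rho> A\<^sub>i \<xi>\<close>. The set \<open>D\<close> is a common domain closed under the
  manipulations involved; the model case is \<open>C\<^sup>\<infinity>(\<real>\<^sup>d)\<close>.\<close>

definition calculus_domain :: "'n::finite fn set \<Rightarrow> bool" where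
  "calculus_domain D \<longleftrightarrow>
     (\<forall>f\<in>D. continuous_on UNIV f) \<and>
     test_functions \<subseteq> D \<and>
     (\<forall>c. (\<lambda>_. c) \<in> D) \<and>
     (\<forall>f\<in>D. \<forall>g\<in>D. (\<lambda>x. f x + g x) \<in> D \<and> (\<lambda>x. f x * g x) \<in> D) \<and>
     (\<forall>f\<in>D. \<forall>\<phi> I. open I \<and> is_interval I \<and> range f \<subseteq> I \<and> smooth_real_on I \<phi>
        \<longrightarrow> (\<lambda>x. \<phi> (f x)) \<in> D)"

definition acts_on :: "'n::finite fn set \<Rightarrow> 'n opr \<Rightarrow> bool" where
  "acts_on D T \<longleftrightarrow> (\<forall>f\<in>D. T f \<in> D)"

definition linear_opr :: "'n::finite fn set \<Rightarrow> 'n opr \<Rightarrow> bool" where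
  "linear_opr D T \<longleftrightarrow>
     (\<forall>f\<in>D. \<forall>g\<in>D. T (\<lambda>x. f x + g x) = (\<lambda>x. T f x + T g x)) \<and>
     (\<forall>f\<in>D. \<forall>c. T (\<lambda>x. c * f x) = (\<lambda>x. c * T f x))"

definition product_rule :: "'n::finite fn set \<Rightarrow> 'n opr \<Rightarrow> bool" where
  "product_rule D T \<longleftrightarrow>
     (\<forall>f\<in>D. \<forall>g\<in>D. T (\<lambda>x. f x * g x) = (\<lambda>x. f x * T g x + g x * T f x))"

definition chain_rule :: "'n::finite fn set \<Rightarrow> 'n opr \<Rightarrow> bool" where
  "chain_rule D T \<longleftrightarrow>
     (\<forall>f\<in>D. \<forall>\<phi> I. open I \<and> is_interval I \<and> range f \<subseteq> I \<and> smooth_real_on I \<phi>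
        \<longrightarrow> T (\<lambda>x. \<phi> (f x)) = (\<lambda>x. deriv \<phi> (f x) * T f x))"

definition positive_in :: "'n::finite fn set \<Rightarrow> 'n fn set" where
  "positive_in V = {\<rho> \<in> V. \<forall>x. \<rho> x > 0}"

text \<open>\<open>(T f, g) = (f, T' g)\<close> in the \<open>w\<close>-weighted pairing, for all \<open>(f, g) \<in> P\<close>. For
  \<open>P = test_pairs D\<close> this is the usual notion of formal adjoint, and it determines \<open>T' g\<close>
  for each \<open>g \<in> D\<close> among continuous functions.\<close>

definition adjoint_on :: "'n::finite fn \<Rightarrow> ('n fn \<times> 'n fn) set \<Rightarrow> 'n opr \<Rightarrow> 'n opr \<Rightarrow> bool" where
  "adjoint_on w P T T' \<longleftrightarrow>
     (\<forall>(f, g)\<in>P. pairable w (T f) g \<and> pairable w f (T' g) \<and>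
        inner_w w (T f) g = inner_w w f (T' g))"

definition test_pairs :: "'n::finite fn set \<Rightarrow> ('n fn \<times> 'n fn) set" where
  "test_pairs D = {(f, g). f \<in> D \<and> g \<in> D \<and> (compactly_supported f \<or> compactly_supported g)}"

section \<open>The Markov process, its semigroup and its generator\<close>

definition markov_kernels :: "(real \<Rightarrow> real^'n::finite \<Rightarrow> (real^'n) measure) \<Rightarrow> bool" where
  "markov_kernels K \<longleftrightarrow>
     (\<forall>t\<ge>0. K t \<in> measurable borel (prob_algebra borel)) \<and>
     (\<forall>x. K 0 x = return borel x) \<and>
     (\<forall>s\<ge>0. \<forall>t\<ge>0. \<forall>x. K (s + t) x = Giry_Monad.bind (K s x) (K t))"

definition markov_process ::
  "'w measure \<Rightarrow> (real \<Rightarrow> 'w \<Rightarrow> real^'n::finite) \<Rightarrow>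
   (real \<Rightarrow> real^'n \<Rightarrow> (real^'n) measure) \<Rightarrow> bool" where
  "markov_process P X K \<longleftrightarrow>
     prob_space P \<and> markov_kernels K \<and> (\<forall>t\<ge>0. X t \<in> borel_measurable P) \<and>
     (\<forall>s\<ge>0. \<forall>t\<ge>0. \<forall>E\<in>sets borel.
        \<forall>F\<in>sigma_sets (space P) {X u -` C \<inter> space P | u C. 0 \<le> u \<and> u \<le> s \<and> C \<in> sets borel}.
          measure P (F \<inter> (X (s + t) -` E)) =
            (\<integral>\<omega>. indicator F \<omega> * measure (K t (X s \<omega>)) E \<partial>P))"

definition invariant_measure ::
  "(real \<Rightarrow> real^'n::finite \<Rightarrow> (real^'n) measure) \<Rightarrow> (real^'n) measure \<Rightarrow> bool" where
  "invariant_measure K m \<longleftrightarrow>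
     prob_space m \<and> sets m = sets borel \<and> (\<forall>t\<ge>0. Giry_Monad.bind m (K t) = m)"

definition semigroup_of ::
  "(real \<Rightarrow> real^'n::finite \<Rightarrow> (real^'n) measure) \<Rightarrow> real \<Rightarrow> 'n opr" where
  "semigroup_of K t f = (\<lambda>x. \<integral>y. f y \<partial>(K t x))"

definition contraction_semigroup :: "'n::finite fn \<Rightarrow> (real \<Rightarrow> 'n opr) \<Rightarrow> bool" where
  "contraction_semigroup w Q \<longleftrightarrow>
     (\<forall>f\<in>L2 w. \<forall>t\<ge>0. Q t f \<in> L2 w \<and> norm2 w (Q t f) \<le> norm2 w f) \<and>
     (\<forall>f\<in>L2 w. AE x in lborel. Q 0 f x = f x) \<and>
     (\<forall>f\<in>L2 w. \<forall>s\<ge>0. \<forall>t\<ge>0. AE x in lborel. Q (s + t) f x = Q s (Q t f) x) \<and>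
     (\<forall>f\<in>L2 w. ((\<lambda>t. norm2 w (\<lambda>x. Q t f x - f x)) \<longlongrightarrow> 0) (at_right 0))"

text \<open>\<open>generates w Q f g\<close>: \<open>f\<close> is in the domain of the \<open>L\<^sup>2\<^sub>w\<close>-generator of \<open>Q\<close>, with value \<open>g\<close>.\<close>

definition generates :: "'n::finite fn \<Rightarrow> (real \<Rightarrow> 'n opr) \<Rightarrow> 'n fn \<Rightarrow> 'n fn \<Rightarrow> bool" where
  "generates w Q f g \<longleftrightarrow> f \<in> L2 w \<and> g \<in> L2 w \<and>
     ((\<lambda>t. norm2 w (\<lambda>x. (Q t f x - f x) / t - g x)) \<longlongrightarrow> 0) (at_right 0)"

definition dom_gen :: "'n::finite fn \<Rightarrow> (real \<Rightarrow> 'n opr) \<Rightarrow> 'n fn set" where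
  "dom_gen w Q = {f. \<exists>g. generates w Q f g}"

definition dom_gen_adj :: "'n::finite fn \<Rightarrow> (real \<Rightarrow> 'n opr) \<Rightarrow> 'n fn set" where
  "dom_gen_adj w Q = {g \<in> L2 w. \<exists>k\<in>L2 w. \<forall>f u. generates w Q f u \<longrightarrow>
     inner_w w u g = inner_w w f k}"

section \<open>Evolution equations\<close>

definition solves :: "'n::finite opr \<Rightarrow> (real \<Rightarrow> 'n fn) \<Rightarrow> bool" where
  "solves F \<rho> \<longleftrightarrow> (\<forall>t>0. \<forall>x. ((\<lambda>s. \<rho> s x) has_real_derivative F (\<rho> t) x) (at t))"

definition positive_classical_solution ::
  "'n::finite fn set \<Rightarrow> 'n opr \<Rightarrow> (real \<Rightarrow> 'n fn) \<Rightarrow> bool" where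
  "positive_classical_solution D F \<rho> \<longleftrightarrow>
     (\<forall>t>0. \<rho> t \<in> positive_in D \<and> integrable lborel (\<rho> t) \<and> \<rho> t \<in> L2 (\<lambda>_. 1)) \<and> solves F \<rho>"

definition dense_class ::
  "'n::finite fn set \<Rightarrow> 'n fn \<Rightarrow> (real \<Rightarrow> 'n opr) \<Rightarrow> 'n opr \<Rightarrow> 'n fn set \<Rightarrow> bool" where
  "dense_class D w Q F V \<longleftrightarrow>
     V \<subseteq> D \<inter> dom_gen w Q \<inter> dom_gen_adj w Q \<and>
     (\<forall>f\<in>V. integrable lborel f \<and> f \<in> L2 (\<lambda>_. 1)) \<and>
     (\<forall>f \<in> dom_gen w Q \<inter> dom_gen_adj w Q. \<forall>e>0. \<exists>g\<in>V. norm2 w (\<lambda>x. f x - g x) < e) \<and>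
     (\<forall>\<rho>. positive_classical_solution D F \<rho> \<longrightarrow> (\<forall>t>0. \<forall>e>0. \<exists>g\<in>V.
        (\<integral>x. \<bar>\<rho> t x - g x\<bar> \<partial>lborel) < e \<and> norm2 (\<lambda>_. 1) (\<lambda>x. \<rho> t x - g x) < e))"

section \<open>Relative entropy and pre-GENERIC form\<close>

definition rel_entropy :: "'n::finite fn \<Rightarrow> 'n fn \<Rightarrow> real" where
  "rel_entropy \<mu> \<rho> = (\<integral>x. ln (\<rho> x / \<mu> x) * \<rho> x \<partial>lborel)"

definition d_rel_entropy :: "'n::finite fn \<Rightarrow> 'n fn \<Rightarrow> 'n fn" where
  "d_rel_entropy \<mu> \<rho> = (\<lambda>x. ln (\<rho> x / \<mu> x) + 1)"

text \<open>Directions are test functions, so that \<open>\<rho> + \<epsilon> g\<close> remains positive for small \<open>\<epsilon>\<close>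
  when \<open>\<rho>\<close> is positive and continuous.\<close>

definition has_functional_derivative ::
  "('n::finite fn \<Rightarrow> real) \<Rightarrow> 'n fn \<Rightarrow> 'n fn \<Rightarrow> bool" where
  "has_functional_derivative S \<rho> \<xi> \<longleftrightarrow>
     (\<forall>g\<in>test_functions. pairable (\<lambda>_. 1) \<xi> g \<and>
        ((\<lambda>\<epsilon>. S (\<lambda>x. \<rho> x + \<epsilon> * g x)) has_real_derivative inner_w (\<lambda>_. 1) \<xi> g) (at 0))"

definition symmetric_psd :: "'n::finite fn set \<Rightarrow> 'n opr \<Rightarrow> bool" where
  "symmetric_psd E T \<longleftrightarrow>
     (\<forall>\<xi>\<in>E. \<forall>\<eta>\<in>E. pairable (\<lambda>_. 1) (T \<xi>) \<eta> \<and>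
        inner_w (\<lambda>_. 1) (T \<xi>) \<eta> = inner_w (\<lambda>_. 1) \<xi> (T \<eta>)) \<and>
     (\<forall>\<xi>\<in>E. 0 \<le> inner_w (\<lambda>_. 1) (T \<xi>) \<xi>)"

text \<open>\<open>\<partial>\<^sub>t \<rho> = F \<rho>\<close> is \<open>\<partial>\<^sub>t \<rho> = W \<rho> - M\<^sub>\<rho> (1/2 \<^bold>d S \<rho>)\<close>, with \<open>dS = \<^bold>d S\<close>. The logarithm
  in the relative entropy restricts all conditions to positive \<open>\<rho>\<close>.\<close>

definition quadratic_pre_GENERIC ::
  "'n::finite fn set \<Rightarrow> 'n fn set \<Rightarrow> 'n opr \<Rightarrow> ('n fn \<Rightarrow> real) \<Rightarrow> ('n fn \<Rightarrow> 'n fn) \<Rightarrow>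
   'n opr \<Rightarrow> ('n fn \<Rightarrow> 'n opr) \<Rightarrow> bool" where
  "quadratic_pre_GENERIC D V F S dS W M \<longleftrightarrow>
     (\<forall>\<rho>\<in>positive_in V. has_functional_derivative S \<rho> (dS \<rho>)) \<and>
     (\<forall>\<rho>\<in>positive_in D. F \<rho> = (\<lambda>x. W \<rho> x - M \<rho> (\<lambda>y. 1/2 * dS \<rho> y) x)) \<and>
     (\<forall>\<rho>\<in>positive_in V. symmetric_psd (V \<union> test_functions) (M \<rho>)) \<and>
     (\<forall>\<rho>\<in>positive_in V. pairable (\<lambda>_. 1) (W \<rho>) (dS \<rho>) \<and>
        inner_w (\<lambda>_. 1) (W \<rho>) (dS \<rho>) = 0)"

text \<open>\<open>2 A'(\<rho> A \<xi>)\<close> for \<open>A = (A\<^sub>1, \<dots>, A\<^sub>d)\<close>, whose dual is \<open>A' J = \<Sum>\<^sub>i A\<^sub>i' J\<^sub>i\<close>.\<close>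

definition wasserstein_opr ::
  "('n::finite \<Rightarrow> 'n opr) \<Rightarrow> ('n \<Rightarrow> 'n opr) \<Rightarrow> 'n fn \<Rightarrow> 'n opr" where
  "wasserstein_opr A A' \<rho> \<xi> = (\<lambda>x. 2 * (\<Sum>i\<in>UNIV. A' i (\<lambda>y. \<rho> y * A i \<xi> y) x))"

definition wasserstein_pre_GENERIC ::
  "'n::finite fn set \<Rightarrow> 'n fn set \<Rightarrow> 'n opr \<Rightarrow> ('n fn \<Rightarrow> real) \<Rightarrow> ('n fn \<Rightarrow> 'n fn) \<Rightarrow>
   'n opr \<Rightarrow> ('n fn \<Rightarrow> 'n opr) \<Rightarrow> bool" where
  "wasserstein_pre_GENERIC D V F S dS W M \<longleftrightarrow>
     quadratic_pre_GENERIC D V F S dS W M \<and>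
     (\<exists>A A'. (\<forall>i. adjoint_on (\<lambda>_. 1) (test_pairs D) (A i) (A' i)) \<and>
        (\<forall>\<rho>\<in>positive_in V. \<forall>\<xi>\<in>D. M \<rho> \<xi> = wasserstein_opr A A' \<rho> \<xi>))"

section \<open>Linear hypocoercive form\<close>

definition sum_AstarA :: "('n::finite \<Rightarrow> 'n opr) \<Rightarrow> ('n \<Rightarrow> 'n opr) \<Rightarrow> 'n opr" where
  "sum_AstarA A Astar f = (\<lambda>x. \<Sum>i\<in>UNIV. Astar i (A i f) x)"

definition linear_hypocoercive_form ::
  "'n::finite fn set \<Rightarrow> 'n fn set \<Rightarrow> 'n fn \<Rightarrow> 'n opr \<Rightarrow> 'n opr \<Rightarrow>
   ('n \<Rightarrow> 'n opr) \<Rightarrow> ('n \<Rightarrow> 'n opr) \<Rightarrow> bool" where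
  "linear_hypocoercive_form D V \<mu> L B A Astar \<longleftrightarrow>
     (\<forall>f\<in>D. L f = (\<lambda>x. B f x - sum_AstarA A Astar f x)) \<and>
     (\<forall>i. acts_on D (A i) \<and> acts_on D (Astar i) \<and> linear_opr D (A i) \<and> chain_rule D (A i) \<and>
        (\<forall>f\<in>V. A i f \<in> L2 \<mu>) \<and>
        adjoint_on \<mu> (test_pairs D \<union> V \<times> V) (A i) (Astar i)) \<and>
     acts_on D B \<and> linear_opr D B \<and> chain_rule D B \<and> product_rule D B \<and> (\<forall>f\<in>V. B f \<in> L2 \<mu>) \<and>
     adjoint_on \<mu> (test_pairs D \<union> V \<times> V) B (\<lambda>g x. - B g x)"

end

theory Submission
  imports Defs
begin

text \<open>
  Everything follows from one identity, \<open>T' (\<mu> f) = \<mu> T\<^sup>* f\<close>, relating the formal adjoint in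
  \<open>L\<^sup>2\<close> to the adjoint in \<open>L\<^sup>2\<^sub>\<mu>\<close> (\<open>formal_adjoint_weight\<close>). It is tested against smooth bumps, and a
  continuous function is determined by these pairings (\<open>test_pairing_determines\<close>).

  \<^emph>\<open>The equation.\<close> Put \<open>h = \<rho> / \<mu>\<close>. The identity applied to \<open>L = B - A\<^sup>* A\<close> gives
  \<open>L' \<rho> = - \<mu> (B h + A\<^sup>* A h)\<close> (\<open>generator_adjoint_weight\<close>), which is also the equation for \<open>h\<close>. For the
  dissipative part, the chain rule turns \<open>\<rho> A (ln h)\<close> into \<open>\<mu> A h\<close>, so that
  \<open>2 A' (\<rho> A (1/2 (ln h + 1))) = A' (\<mu> A h) = \<mu> A\<^sup>* A h\<close> (\<open>wasserstein_opr_d_rel_entropy\<close>). For the drift,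
  antisymmetry says \<open>B' f = - \<mu> B (f / \<mu>)\<close>. As \<open>B'\<close> is a derivation as well, \<open>B' 1 = 0\<close>, and taking \<open>f = 1\<close>
  yields \<open>B \<mu> = 0\<close> (\<open>antisymmetric_derivation_kills_weight\<close>): the flow of \<open>B\<close> preserves both Lebesgue
  measure and \<open>\<mu>\<close>. Hence \<open>\<mu> B h = B \<rho>\<close>, and also \<open>B' \<rho> = - B \<rho>\<close>.

  \<^emph>\<open>The structure.\<close> Moving \<open>A'\<close> to the other side, \<open>(M\<^sub>\<rho> \<xi>, \<eta>) = 2 \<Sum>\<^sub>i \<integral> \<rho> A\<^sub>i \<xi> A\<^sub>i \<eta>\<close>, which is symmetric and
  nonnegative on the diagonal. The degeneracy condition comes from
  \<open>(B \<rho>, ln h) = (\<rho>, B' (ln h)) = (\<mu>, B' h) = - (B \<rho>, 1) = - (\<rho>, B' 1) = 0\<close>.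

  The operators are abstract maps, so that it has to be proved that \<open>A\<^sub>i \<phi>\<close> has compact support when \<open>\<phi>\<close>
  does; this is what makes it admissible in the pairings. A map satisfying the product rule is
  local, as multiplication by a bump shows (\<open>derivation_local\<close>).
\<close>

section \<open>Smooth functions and bumps\<close>

text \<open>Iterates of \<open>deriv\<close> are awkward to compute, as \<open>deriv\<close> is only meaningful where the derivative
  exists. An explicit candidate \<open>F k\<close> for the \<open>k\<close>-th derivative avoids this; openness of \<open>I\<close> lets each
  iterate be replaced by its candidate before it is differentiated again.\<close>

lemma smooth_real_onI:
  fixes F :: "nat \<Rightarrow> real \<Rightarrow> real"
  assumes "open I" and F0: "\<And>y. y \<in> I \<Longrightarrow> F 0 y = \<phi> y"
    and F: "\<And>k y. y \<in> I \<Longrightarrow> (F k has_real_derivative F (Suc k) y) (at y)"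
  shows "smooth_real_on I \<phi>"
proof -
  have der: "((deriv ^^ k) \<phi> has_real_derivative F (Suc k) y) (at y)"
    if "y \<in> I" and eq: "\<And>z. z \<in> I \<Longrightarrow> (deriv ^^ k) \<phi> z = F k z" for k y
    by (rule has_field_derivative_transform_within_open[OF F[OF that(1)] \<open>open I\<close> that(1)])
       (simp add: eq)
  have eq: "(deriv ^^ k) \<phi> y = F k y" if "y \<in> I" for k y
    using that
  proof (induction k arbitrary: y)
    case 0 then show ?case by (simp add: F0)
  next
    case (Suc k)
    then show ?case using der[of y k] by (simp add: DERIV_imp_deriv)
  qed
  show ?thesis
    unfolding smooth_real_on_def field_differentiable_def using der eq by blast
qed

lemma smooth_real_on_deriv: "smooth_real_on I \<phi> \<Longrightarrow> smooth_real_on I (deriv \<phi>)"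
  unfolding smooth_real_on_def by (metis funpow_simps_right(2) comp_apply)

lemma smooth_power2: "smooth_real_on UNIV (\<lambda>y. y\<^sup>2)"
  by (rule smooth_real_onI[where F = "\<lambda>k y. if k = 0 then y\<^sup>2 else if k = 1 then 2 * y
        else if k = 2 then 2 else 0"])
     (auto intro!: derivative_eq_intros)

lemma smooth_inverse: "smooth_real_on {0<..} inverse"
proof (rule smooth_real_onI[where F = "\<lambda>k y. (-1) ^ k * fact k * inverse (y ^ Suc k)"])
  fix k :: nat and y :: real assume "y \<in> {0<..}"
  then show "((\<lambda>y. (-1) ^ k * fact k * inverse (y ^ Suc k)) has_real_derivative
      (-1) ^ Suc k * fact (Suc k) * inverse (y ^ Suc (Suc k))) (at y)"
    by (auto intro!: derivative_eq_intros simp: field_simps simp del: power_Suc)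
       (auto simp: field_simps)
qed auto

lemma smooth_ln: "smooth_real_on {0<..} (ln :: real \<Rightarrow> real)"
proof (rule smooth_real_onI[where F = "\<lambda>k. case k of 0 \<Rightarrow> ln | Suc j \<Rightarrow> (deriv ^^ j) inverse"])
  fix k :: nat and y :: real assume y: "y \<in> {0<..}"
  show "((case k of 0 \<Rightarrow> ln | Suc j \<Rightarrow> (deriv ^^ j) inverse) has_real_derivative
      (case Suc k of 0 \<Rightarrow> ln | Suc j \<Rightarrow> (deriv ^^ j) inverse) y) (at y)"
  proof (cases k)
    case 0 then show ?thesis using y by (auto intro!: derivative_eq_intros simp: inverse_eq_divide)
  next
    case (Suc j)
    then show ?thesis using smooth_inverse y
      by (auto simp: smooth_real_on_def field_differentiable_derivI)
  qed
qed auto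

text \<open>For \<open>p = 1\<close> this is the classical smooth function that is flat at \<open>0\<close>. With the polynomial factor the
  family is closed under differentiation, so that smoothness reduces to the first derivative.\<close>

definition flat :: "real poly \<Rightarrow> real \<Rightarrow> real" where
  "flat p s = (if s > 0 then poly p (1 / s) * exp (- (1 / s)) else 0)"

lemma poly_times_exp_neg: "((\<lambda>y. poly p y * exp (- y)) \<longlongrightarrow> (0::real)) at_top"
proof (induction p rule: pCons_induct)
  case 0 then show ?case by simp
next
  case (pCons a p)
  have *: "((\<lambda>y::real. poly p y * y * exp (- y)) \<longlongrightarrow> 0) at_top" for p :: "real poly"
  proof -
    have "((\<lambda>y::real. \<Sum>i\<le>degree p. coeff p i * (y ^ Suc i / exp y)) \<longlongrightarrow> (\<Sum>i\<le>degree p. coeff p i * 0)) at_top"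
      by (intro tendsto_intros tendsto_power_div_exp_0)
    also have "(\<lambda>y::real. \<Sum>i\<le>degree p. coeff p i * (y ^ Suc i / exp y)) = (\<lambda>y. poly p y * y * exp (- y))"
      by (auto simp: poly_altdef sum_distrib_left exp_minus divide_simps fun_eq_iff mult_ac intro!: sum.cong)
    finally show ?thesis by simp
  qed
  have e: "((\<lambda>y::real. a * exp (- y)) \<longlongrightarrow> a * 0) at_top"
    by (intro tendsto_intros) (rule filterlim_compose[OF exp_at_bot filterlim_uminus_at_bot_at_top])
  show ?case using tendsto_add[OF e *[of p]] by (simp add: algebra_simps)
qed

lemma flat_has_derivative:
  "(flat p has_real_derivative flat ([:0, 0, 1:] * (p - pderiv p)) s) (at s)"
proof -
  consider "s > 0" | "s < 0" | "s = 0" by linarith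
  then show ?thesis
  proof cases
    case 1
    have "((\<lambda>s. poly p (1 / s) * exp (- (1 / s))) has_real_derivative
        flat ([:0, 0, 1:] * (p - pderiv p)) s) (at s)"
    proof -
      have i: "((\<lambda>s. 1 / s) has_real_derivative - (1 / s\<^sup>2)) (at s)"
        using 1 by (auto intro!: derivative_eq_intros simp: power2_eq_square)
      have "((\<lambda>s. poly p (1 / s) * exp (- (1 / s))) has_real_derivative
          (poly (pderiv p) (1 / s) * - (1 / s\<^sup>2)) * exp (- (1 / s)) +
          (exp (- (1 / s)) * - (- (1 / s\<^sup>2))) * poly p (1 / s)) (at s)"
        by (intro DERIV_mult DERIV_fun_exp DERIV_minus i DERIV_chain2[OF poly_DERIV i])
      then show ?thesis
        by (rule DERIV_cong) (use 1 in \<open>simp add: flat_def power2_eq_square algebra_simps\<close>)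
    qed
    then show ?thesis
      by (rule has_field_derivative_transform_within_open[where S = "{0<..}"])
         (use 1 in \<open>auto simp: flat_def\<close>)
  next
    case 2
    have "((\<lambda>s. 0) has_real_derivative flat ([:0, 0, 1:] * (p - pderiv p)) s) (at s)"
      using 2 by (simp add: flat_def)
    then show ?thesis
      by (rule has_field_derivative_transform_within_open[where S = "{..<0}"])
         (use 2 in \<open>auto simp: flat_def\<close>)
  next
    case 3
    \<comment> \<open>The additional factor \<open>1 / h\<close> of the difference quotient is absorbed into the polynomial.\<close>
    have r: "((\<lambda>h. flat p h / h) \<longlongrightarrow> 0) (at_right 0)"
    proof -
      have "((\<lambda>h. poly (pCons 0 p) (inverse h) * exp (- inverse h)) \<longlongrightarrow> (0::real)) (at_right 0)"
        by (rule filterlim_compose[OF poly_times_exp_neg filterlim_inverse_at_top_right])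
      then show ?thesis
        by (rule Lim_transform_eventually)
           (auto simp: flat_def field_simps eventually_at_right_less intro!: eventually_at_rightI[of 0 1])
    qed
    have l: "((\<lambda>h. flat p h / h) \<longlongrightarrow> 0) (at_left 0)"
      by (rule Lim_transform_eventually[OF tendsto_const])
         (auto simp: flat_def intro!: eventually_at_leftI[of "-1"])
    have "((\<lambda>h. flat p h / h) \<longlongrightarrow> 0) (at 0)"
      using filterlim_split_at[OF l r] by simp
    then show ?thesis using 3 by (simp add: DERIV_def flat_def)
  qed
qed

lemma smooth_flat: "smooth_real_on UNIV (flat p)"
  by (rule smooth_real_onI[where F = "\<lambda>k. flat (((\<lambda>q. [:0, 0, 1:] * (q - pderiv q)) ^^ k) p)"])
     (auto intro: flat_has_derivative simp del: mult_pCons_left)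

lemma Ck_SucI:
  assumes "\<And>x. (f has_derivative F x) (at x)" "\<And>i. Ck k (\<lambda>x. F x (axis i 1))"
  shows "Ck (Suc k) f"
proof -
  have "frechet_derivative f (at x) = F x" for x
    using frechet_derivative_at[OF assms(1)] by simp
  then show ?thesis using assms by (auto simp: differentiable_def)
qed

lemma Ck_SucD:
  assumes "Ck (Suc k) f"
  shows "(f has_derivative frechet_derivative f (at x)) (at x)"
    "Ck k (\<lambda>x. frechet_derivative f (at x) (axis i 1))"
  using assms by (auto simp: frechet_derivative_works)

lemma Ck_Suc_imp: "Ck (Suc k) f \<Longrightarrow> Ck k f"
proof (induction k arbitrary: f)
  case 0
  then show ?case
    by (auto intro!: differentiable_imp_continuous_on simp: differentiable_on_def)
next
  case (Suc k)
  then show ?case by (metis Ck.simps(2))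
qed

lemma Ck_add: "Ck k f \<Longrightarrow> Ck k g \<Longrightarrow> Ck k (\<lambda>x. f x + g x)"
proof (induction k arbitrary: f g)
  case 0 then show ?case by (auto intro: continuous_intros)
next
  case (Suc k)
  show ?case
    by (rule Ck_SucI[OF has_derivative_add[OF Ck_SucD(1)[OF Suc.prems(1)] Ck_SucD(1)[OF Suc.prems(2)]]])
       (intro Suc.IH Ck_SucD(2) Suc.prems)
qed

lemma Ck_mult: "Ck k f \<Longrightarrow> Ck k g \<Longrightarrow> Ck k (\<lambda>x. f x * g x)"
proof (induction k arbitrary: f g)
  case 0 then show ?case by (auto intro: continuous_intros)
next
  case (Suc k)
  show ?case
    by (rule Ck_SucI[OF has_derivative_mult[OF Ck_SucD(1)[OF Suc.prems(1)] Ck_SucD(1)[OF Suc.prems(2)]]])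
       (intro Ck_add Suc.IH Ck_SucD(2) Suc.prems Ck_Suc_imp)
qed

lemma Ck_compose: "smooth_real_on UNIV \<phi> \<Longrightarrow> Ck k f \<Longrightarrow> Ck k (\<lambda>x. \<phi> (f x))"
proof (induction k arbitrary: \<phi> f)
  case 0
  then have "\<forall>y. \<phi> field_differentiable (at y)"
    unfolding smooth_real_on_def by (metis UNIV_I funpow_0)
  then have "continuous_on UNIV \<phi>"
    by (simp add: continuous_at_imp_continuous_on field_differentiable_imp_continuous_at)
  then show ?case using 0(2) continuous_on_compose2[of UNIV \<phi> UNIV f] by simp
next
  case (Suc k)
  have "\<phi> field_differentiable (at y)" for y
    using Suc.prems(1) unfolding smooth_real_on_def by (metis UNIV_I funpow_0)
  then have d: "(\<phi> has_real_derivative deriv \<phi> y) (at y)" for y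
    by (simp add: field_differentiable_derivI)
  show ?case
  proof (rule Ck_SucI)
    show "((\<lambda>x. \<phi> (f x)) has_derivative (\<lambda>h. deriv \<phi> (f x) * frechet_derivative f (at x) h)) (at x)" for x
      using has_derivative_compose[OF Ck_SucD(1)[OF Suc.prems(2)] d[unfolded has_field_derivative_def]]
      by simp
    show "Ck k (\<lambda>x. deriv \<phi> (f x) * frechet_derivative f (at x) (axis i 1))" for i
      by (rule Ck_mult[OF Suc.IH[OF smooth_real_on_deriv[OF Suc.prems(1)] Ck_Suc_imp[OF Suc.prems(2)]]
            Ck_SucD(2)[OF Suc.prems(2)]])
  qed
qed

lemma Ck_const: "Ck k (\<lambda>x. c)"
proof (induction k arbitrary: c)
  case 0 then show ?case by simp
next
  case (Suc k) show ?case by (rule Ck_SucI[OF has_derivative_const Suc])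
qed

lemma Ck_inner: "Ck k (\<lambda>x. v \<bullet> x)"
proof (cases k)
  case 0 then show ?thesis by (auto intro: continuous_intros)
next
  case (Suc j)
  then show ?thesis
    using Ck_SucI[OF bounded_linear_imp_has_derivative[OF bounded_linear_inner_right] Ck_const]
    by blast
qed

lemma Ck_norm_square: "Ck k (\<lambda>x. (x - a) \<bullet> (x - a))"
proof (cases k)
  case 0 then show ?thesis by (auto intro!: continuous_intros)
next
  case (Suc j)
  have "Ck (Suc j) (\<lambda>x. (x - a) \<bullet> (x - a))"
  proof (rule Ck_SucI)
    show "((\<lambda>x. (x - a) \<bullet> (x - a)) has_derivative (\<lambda>h. -2 * (a \<bullet> h) + (2 *\<^sub>R h) \<bullet> x)) (at x)" for x
      by (auto intro!: derivative_eq_intros simp: inner_commute algebra_simps)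
    show "Ck j (\<lambda>x. -2 * (a \<bullet> axis i 1) + (2 *\<^sub>R axis i 1) \<bullet> x)" for i
      by (intro Ck_add Ck_const Ck_inner)
  qed
  then show ?thesis using Suc by simp
qed

lemma compactly_supported_subset:
  assumes "compact K" "\<And>x. x \<notin> K \<Longrightarrow> f x = 0"
  shows "compactly_supported f"
proof -
  have "closure {x. f x \<noteq> 0} \<subseteq> K"
    using assms by (intro closure_minimal compact_imp_closed) auto
  then have "bounded (closure {x. f x \<noteq> 0})"
    using assms(1) bounded_subset compact_imp_bounded by blast
  then show ?thesis
    unfolding compactly_supported_def by (simp add: compact_eq_bounded_closed)
qed

text \<open>The bump is \<open>exp (- 1 / s)\<close> at \<open>s = r\<^sup>2 - \<bar>x - a\<bar>\<^sup>2\<close>, extended by zero to \<open>s \<le> 0\<close>.\<close>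

lemma exists_bump:
  fixes a :: "real^'n::finite"
  assumes "r > 0"
  shows "\<exists>\<phi>\<in>test_functions. (\<forall>x. 0 \<le> \<phi> x) \<and> 0 < \<phi> a \<and> (\<forall>x. \<phi> x \<noteq> 0 \<longrightarrow> x \<in> ball a r)"
proof -
  define \<phi> where "\<phi> x = flat 1 (r\<^sup>2 + (-1) * ((x - a) \<bullet> (x - a)))" for x
  have supp: "x \<in> ball a r" if "\<phi> x \<noteq> 0" for x
  proof -
    have "0 < r\<^sup>2 + (-1) * ((x - a) \<bullet> (x - a))"
      using that unfolding \<phi>_def flat_def by presburger
    then have "(norm (x - a))\<^sup>2 < r\<^sup>2"
      unfolding power2_norm_eq_inner by linarith
    then show ?thesis
      using assms power2_less_imp_less[of "norm (x - a)" r] by (simp add: dist_norm norm_minus_commute)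
  qed
  have "Ck k \<phi>" for k
    unfolding \<phi>_def
    by (rule Ck_compose[OF smooth_flat Ck_add[OF Ck_const Ck_mult[OF Ck_const Ck_norm_square]]])
  moreover have "compactly_supported \<phi>"
    by (rule compactly_supported_subset[of "cball a r"]) (use supp in fastforce)+
  ultimately have "\<phi> \<in> test_functions" by (simp add: test_functions_def)
  moreover have "0 \<le> \<phi> x" for x by (simp add: \<phi>_def flat_def)
  moreover have "0 < \<phi> a" using assms by (simp add: \<phi>_def flat_def)
  ultimately show ?thesis using supp by blast
qed

lemma test_functionsD:
  assumes "\<phi> \<in> test_functions"
  shows "continuous_on UNIV \<phi>" "compactly_supported \<phi>"
  using assms unfolding test_functions_def by (auto dest: spec[where x = 0])

section \<open>Integral pairings\<close>

lemma integrable_compactly_supported: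
  fixes f :: "'n::finite fn"
  assumes "continuous_on UNIV f" "compactly_supported f"
  shows "integrable lborel f"
proof -
  have "integrable lborel (\<lambda>x. indicator (closure {x. f x \<noteq> 0}) x *\<^sub>R f x)"
    using assms continuous_on_subset
    by (intro borel_integrable_compact) (auto simp: compactly_supported_def)
  also have "(\<lambda>x. indicator (closure {x. f x \<noteq> 0}) x *\<^sub>R f x) = f"
  proof
    show "indicator (closure {x. f x \<noteq> 0}) x *\<^sub>R f x = f x" for x
      using closure_subset[of "{x. f x \<noteq> 0}"] by (cases "f x = 0") auto
  qed
  finally show ?thesis .
qed

lemma compactly_supported_mult:
  assumes "compactly_supported f \<or> compactly_supported g"
  shows "compactly_supported (\<lambda>x. f x * g x)"
  using assms
proof
  assume "compactly_supported f"
  then show ?thesis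
    using closure_subset[of "{x. f x \<noteq> 0}"]
    by (intro compactly_supported_subset[of "closure {x. f x \<noteq> 0}"])
       (auto simp: compactly_supported_def)
next
  assume "compactly_supported g"
  then show ?thesis
    using closure_subset[of "{x. g x \<noteq> 0}"]
    by (intro compactly_supported_subset[of "closure {x. g x \<noteq> 0}"])
       (auto simp: compactly_supported_def)
qed

text \<open>The fundamental lemma of the calculus of variations: where \<open>u > v\<close>, a bump supported in a small ball
  would make the difference of the two integrals strictly positive.\<close>

lemma test_pairing_determines:
  fixes u v :: "'n::finite fn"
  assumes cont: "continuous_on UNIV u" "continuous_on UNIV v"
    and eq: "\<And>\<phi>. \<phi> \<in> test_functions \<Longrightarrow> (\<integral>x. \<phi> x * u x \<partial>lborel) = (\<integral>x. \<phi> x * v x \<partial>lborel)"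
  shows "u = v"
proof -
  have le: "u a \<le> v a"
    if "continuous_on UNIV u" "continuous_on UNIV v"
      and eq: "\<And>\<phi>. \<phi> \<in> test_functions \<Longrightarrow> (\<integral>x. \<phi> x * u x \<partial>lborel) = (\<integral>x. \<phi> x * v x \<partial>lborel)"
    for u v :: "'n fn" and a
  proof (rule ccontr)
    assume "\<not> u a \<le> v a"
    have "open {x. v x < u x}"
      using that(1,2) by (intro open_Collect_less) auto
    then obtain r where r: "r > 0" "ball a r \<subseteq> {x. v x < u x}"
      using \<open>\<not> u a \<le> v a\<close> by (metis mem_Collect_eq not_le openE)
    obtain \<phi> where \<phi>: "\<phi> \<in> test_functions" "\<And>x. 0 \<le> \<phi> x" "0 < \<phi> a"
      "\<And>x. \<phi> x \<noteq> 0 \<Longrightarrow> x \<in> ball a r"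
      using exists_bump[OF r(1), of a] by blast
    note c\<phi> = test_functionsD[OF \<phi>(1)]
    have int: "integrable lborel (\<lambda>x. \<phi> x * w x)" if "continuous_on UNIV w" for w
      using that c\<phi> by (intro integrable_compactly_supported compactly_supported_mult continuous_intros) auto
    define w where "w x = \<phi> x * (u x - v x)" for x
    have cw: "continuous_on UNIV w"
      unfolding w_def by (intro continuous_intros c\<phi> that)
    have w0: "0 \<le> w x" for x
      using \<phi>(2)[of x] \<phi>(4)[of x] r(2) by (cases "\<phi> x = 0") (auto simp: w_def)
    have iw: "integrable lborel w"
      unfolding w_def by (intro int continuous_intros that)
    have "integral\<^sup>L lborel w = 0"
      using eq[OF \<phi>(1)] int[OF that(1)] int[OF that(2)] by (simp add: w_def[abs_def] right_diff_distrib)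
    then have "AE x in lborel. w x = 0"
      using integral_nonneg_eq_0_iff_AE[OF iw] w0 by simp
    then have "AE x in lborel. \<not> 0 < w x" by auto
    moreover have "w a > 0"
      using \<phi>(3) \<open>\<not> u a \<le> v a\<close> by (simp add: w_def)
    moreover have op: "open {x. 0 < w x}"
      using cw by (intro open_Collect_less) auto
    ultimately have "{x. 0 < w x} \<in> null_sets lborel"
      using AE_iff_null[of lborel "\<lambda>x. \<not> 0 < w x"] by simp
    then have "negligible {x. 0 < w x}"
      using null_sets_completionI negligible_iff_null_sets by blast
    then show False
      using open_not_negligible[OF op] \<open>w a > 0\<close> by blast
  qed
  show ?thesis
    using le[OF cont eq] le[OF cont(2,1) eq[symmetric]] by (intro ext antisym) auto
qed

section \<open>Derivations and formal adjoints\<close>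

lemma calculus_domainD:
  assumes "calculus_domain D"
  shows "f \<in> D \<Longrightarrow> continuous_on UNIV f" "test_functions \<subseteq> D" "(\<lambda>_. c) \<in> D"
    "f \<in> D \<Longrightarrow> g \<in> D \<Longrightarrow> (\<lambda>x. f x + g x) \<in> D"
    "f \<in> D \<Longrightarrow> g \<in> D \<Longrightarrow> (\<lambda>x. f x * g x) \<in> D"
    "f \<in> D \<Longrightarrow> (\<lambda>x. c * f x) \<in> D"
    "f \<in> D \<Longrightarrow> open I \<Longrightarrow> is_interval I \<Longrightarrow> range f \<subseteq> I \<Longrightarrow> smooth_real_on I \<phi>
      \<Longrightarrow> (\<lambda>x. \<phi> (f x)) \<in> D"
proof -
  have const: "(\<lambda>_. c) \<in> D" for c
    using assms unfolding calculus_domain_def by (elim conjE) (drule spec)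
  have alg: "(\<lambda>x. f x + g x) \<in> D \<and> (\<lambda>x. f x * g x) \<in> D" if "f \<in> D" "g \<in> D" for f g
    using assms that unfolding calculus_domain_def by (elim conjE) (drule (1) bspec)+
  show "f \<in> D \<Longrightarrow> continuous_on UNIV f" "test_functions \<subseteq> D"
    using assms unfolding calculus_domain_def by (elim conjE, simp)+
  show "(\<lambda>_. c) \<in> D" "f \<in> D \<Longrightarrow> g \<in> D \<Longrightarrow> (\<lambda>x. f x + g x) \<in> D"
    "f \<in> D \<Longrightarrow> g \<in> D \<Longrightarrow> (\<lambda>x. f x * g x) \<in> D" "f \<in> D \<Longrightarrow> (\<lambda>x. c * f x) \<in> D"
    using const[of c] alg alg[OF const] by simp_all
  show "f \<in> D \<Longrightarrow> open I \<Longrightarrow> is_interval I \<Longrightarrow> range f \<subseteq> I \<Longrightarrow> smooth_real_on I \<phi>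
      \<Longrightarrow> (\<lambda>x. \<phi> (f x)) \<in> D"
    using assms unfolding calculus_domain_def
    by (elim conjE) (drule (1) bspec, drule spec[of _ \<phi>], drule spec[of _ I], blast)
qed

lemma chain_ruleD:
  assumes "chain_rule D T" "f \<in> D" "open I" "is_interval I" "range f \<subseteq> I" "smooth_real_on I \<phi>"
  shows "T (\<lambda>x. \<phi> (f x)) x = deriv \<phi> (f x) * T f x"
  using assms unfolding chain_rule_def by (metis (no_types, lifting))

lemma linear_oprD:
  assumes "linear_opr D T" "f \<in> D"
  shows "g \<in> D \<Longrightarrow> T (\<lambda>x. f x + g x) x = T f x + T g x" "T (\<lambda>x. c * f x) x = c * T f x"
  using assms unfolding linear_opr_def by metis+

text \<open>Polarisation: apply the chain rule for \<open>y\<^sup>2\<close> to \<open>f\<close>, \<open>g\<close> and \<open>f + g\<close>. The hypocoercive form endows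
  the linear operators \<open>A\<^sub>i\<close> with a chain rule but not with a product rule.\<close>

lemma chain_rule_imp_product_rule:
  assumes D: "calculus_domain D" and "linear_opr D T" "chain_rule D T"
  shows "product_rule D T"
  unfolding product_rule_def
proof (intro ballI ext)
  fix f g x assume fg: "f \<in> D" "g \<in> D"
  note Ds = calculus_domainD[OF D]
  have sq: "T (\<lambda>x. (h x)\<^sup>2) x = 2 * h x * T h x" if "h \<in> D" for h x
    using chain_ruleD[OF assms(3) that, of UNIV "\<lambda>y. y\<^sup>2"] smooth_power2
    by (simp add: DERIV_imp_deriv[OF DERIV_pow[of 2]])
  have sqD: "(\<lambda>x. (h x)\<^sup>2) \<in> D" if "h \<in> D" for h
    using Ds(5)[OF that that] by (simp add: power2_eq_square)
  have "2 * (f x + g x) * (T f x + T g x) = T (\<lambda>x. (f x + g x)\<^sup>2) x"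
    using sq[OF Ds(4)[OF fg]] by (simp add: linear_oprD[OF assms(2)] fg)
  also have "(\<lambda>x. (f x + g x)\<^sup>2) = (\<lambda>x. ((f x)\<^sup>2 + 2 * (f x * g x)) + (g x)\<^sup>2)"
    by (simp add: power2_sum fun_eq_iff)
  also have "T \<dots> x = 2 * f x * T f x + 2 * T (\<lambda>x. f x * g x) x + 2 * g x * T g x"
    by (simp add: linear_oprD[OF assms(2)] sq sqD fg Ds(4-6))
  finally show "T (\<lambda>x. f x * g x) x = f x * T g x + g x * T f x"
    by (simp add: algebra_simps)
qed

lemma product_ruleD:
  assumes "product_rule D T" "f \<in> D" "g \<in> D"
  shows "T (\<lambda>x. f x * g x) x = f x * T g x + g x * T f x"
  using assms unfolding product_rule_def by metis

lemma derivation_one: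
  assumes "calculus_domain D" "product_rule D T"
  shows "T (\<lambda>_. 1) x = 0"
  using product_ruleD[OF assms(2) calculus_domainD(3,3)[OF assms(1), of 1], of x] by simp

text \<open>A bump \<open>\<phi>\<close> with \<open>\<phi> x > 0\<close> supported off the support of \<open>f\<close> has \<open>\<phi> f = 0\<close>, so that the product rule at
  \<open>x\<close> reads \<open>0 = \<phi> x * T f x\<close>.\<close>

lemma derivation_local:
  assumes D: "calculus_domain D" and T: "product_rule D T" and f: "f \<in> D"
    and x: "x \<notin> closure {x. f x \<noteq> 0}"
  shows "T f x = 0"
proof -
  obtain r where r: "r > 0" "ball x r \<subseteq> - closure {x. f x \<noteq> 0}"
    using x by (metis ComplI closed_closure open_Compl openE)
  obtain \<phi> where \<phi>: "\<phi> \<in> test_functions" "0 < \<phi> x" "\<And>y. \<phi> y \<noteq> 0 \<Longrightarrow> y \<in> ball x r"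
    using exists_bump[OF r(1), of x] by blast
  have f0: "f y = 0" if "y \<in> ball x r" for y
    using that r(2) closure_subset[of "{x. f x \<noteq> 0}"] by auto
  have "(\<lambda>y. \<phi> y * f y) = (\<lambda>_. 0)"
    using \<phi>(3) f0 by (metis mult_eq_0_iff)
  moreover have "T (\<lambda>_. 0) x = 0"
    using product_ruleD[OF T calculus_domainD(3,3)[OF D, of 0], of x] by simp
  ultimately have "0 = \<phi> x * T f x + f x * T \<phi> x"
    using product_ruleD[OF T subsetD[OF calculus_domainD(2)[OF D] \<phi>(1)] f, of x] by simp
  then show ?thesis using \<phi>(2) f0[of x] r(1) by simp
qed

lemma derivation_compactly_supported:
  assumes "calculus_domain D" "product_rule D T" "f \<in> D" "compactly_supported f"
  shows "compactly_supported (T f)"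
  by (rule compactly_supported_subset[of "closure {x. f x \<noteq> 0}"])
     (use assms derivation_local in \<open>auto simp: compactly_supported_def\<close>)

lemma adjoint_onD:
  assumes "adjoint_on w P T T'" "(f, g) \<in> P"
  shows "integrable lborel (\<lambda>x. T f x * g x * w x)" "integrable lborel (\<lambda>x. f x * T' g x * w x)"
    "(\<integral>x. T f x * g x * w x \<partial>lborel) = (\<integral>x. f x * T' g x * w x \<partial>lborel)"
  using assms unfolding adjoint_on_def pairable_def inner_w_def by auto

lemma test_pair:
  assumes "calculus_domain D" "\<phi> \<in> test_functions" "f \<in> D"
  shows "(\<phi>, f) \<in> test_pairs D"
  using assms(3) subsetD[OF calculus_domainD(2)[OF assms(1)] assms(2)] test_functionsD(2)[OF assms(2)]
  by (simp add: test_pairs_def)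

lemma formal_adjoint_eqI:
  assumes D: "calculus_domain D" and adj: "adjoint_on (\<lambda>_. 1) (test_pairs D) T T'"
    and T': "acts_on D T'" and "g \<in> D" "v \<in> D"
    and eq: "\<And>\<phi>. \<phi> \<in> test_functions \<Longrightarrow> (\<integral>x. T \<phi> x * g x \<partial>lborel) = (\<integral>x. \<phi> x * v x \<partial>lborel)"
  shows "T' g = v"
proof (rule test_pairing_determines)
  show "continuous_on UNIV (T' g)" "continuous_on UNIV v"
    using assms by (auto simp: acts_on_def intro: calculus_domainD(1)[OF D])
  show "(\<integral>x. \<phi> x * T' g x \<partial>lborel) = (\<integral>x. \<phi> x * v x \<partial>lborel)" if "\<phi> \<in> test_functions" for \<phi>
    using eq[OF that] adjoint_onD(3)[OF adj test_pair[OF D that \<open>g \<in> D\<close>]] by simp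
qed

text \<open>Linearity of a formal adjoint is a consequence of its uniqueness.\<close>

lemma formal_adjoint_scale:
  assumes D: "calculus_domain D" and adj: "adjoint_on (\<lambda>_. 1) (test_pairs D) T T'"
    and T': "acts_on D T'" and g: "g \<in> D"
  shows "T' (\<lambda>x. c * g x) = (\<lambda>x. c * T' g x)"
proof (rule formal_adjoint_eqI[OF D adj T'])
  show "(\<lambda>x. c * g x) \<in> D" "(\<lambda>x. c * T' g x) \<in> D"
    using T' g calculus_domainD(6)[OF D] by (auto simp: acts_on_def)
  fix \<phi> :: "'a fn" assume \<phi>: "\<phi> \<in> test_functions"
  have "(\<integral>x. T \<phi> x * (c * g x) \<partial>lborel) = c * (\<integral>x. T \<phi> x * g x \<partial>lborel)"
    by (simp add: mult.left_commute)
  also have "\<dots> = (\<integral>x. \<phi> x * (c * T' g x) \<partial>lborel)"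
    using adjoint_onD(3)[OF adj test_pair[OF D \<phi> g]] by (simp add: mult.left_commute)
  finally show "(\<integral>x. T \<phi> x * (c * g x) \<partial>lborel) = (\<integral>x. \<phi> x * (c * T' g x) \<partial>lborel)" .
qed

text \<open>Both sides represent \<open>\<phi> \<mapsto> \<integral> T \<phi> f \<mu>\<close>: on the left with \<open>\<mu>\<close> as part of the argument, on the right
  with \<open>\<mu>\<close> as the weight.\<close>

lemma formal_adjoint_weight:
  assumes D: "calculus_domain D" "\<mu> \<in> D" and adj: "adjoint_on (\<lambda>_. 1) (test_pairs D) T T'"
    and adj\<mu>: "adjoint_on \<mu> (test_pairs D) T S"
    and acts: "acts_on D T'" "acts_on D S" and f: "f \<in> D"
  shows "T' (\<lambda>x. \<mu> x * f x) = (\<lambda>x. \<mu> x * S f x)"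
proof (rule formal_adjoint_eqI[OF D(1) adj acts(1)])
  show "(\<lambda>x. \<mu> x * f x) \<in> D" "(\<lambda>x. \<mu> x * S f x) \<in> D"
    using acts D f calculus_domainD(5)[OF D(1)] by (auto simp: acts_on_def)
  show "(\<integral>x. T \<phi> x * (\<mu> x * f x) \<partial>lborel) = (\<integral>x. \<phi> x * (\<mu> x * S f x) \<partial>lborel)"
    if "\<phi> \<in> test_functions" for \<phi>
    using adjoint_onD(3)[OF adj\<mu> test_pair[OF D(1) that f]] by (simp add: mult_ac)
qed

section \<open>The functional derivative of the relative entropy\<close>

text \<open>The remainder is that of the convex function \<open>s ln (s / m)\<close> at \<open>a\<close>. Both bounds are \<open>ln y \<le> y - 1\<close>, at
  \<open>y = a / b\<close> and at \<open>y = b / a\<close>. The upper bound is exact rather than asymptotic and free of \<open>m\<close>, so it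
  can be integrated without any uniformity argument.\<close>

lemma entropy_remainder:
  fixes a b m :: real
  assumes "a > 0" "b > 0" "m > 0"
  defines "R \<equiv> ln (b / m) * b - ln (a / m) * a - (ln (a / m) + 1) * (b - a)"
  shows "0 \<le> R" "R \<le> (b - a)\<^sup>2 / a"
proof -
  have R: "R = b * (ln b - ln a) - (b - a)"
    using assms by (simp add: R_def ln_div algebra_simps)
  have "ln a - ln b \<le> a / b - 1"
    using ln_le_minus_one[of "a / b"] assms by (simp add: ln_div)
  then have "b * (ln a - ln b) \<le> b * (a / b - 1)"
    using assms by (intro mult_left_mono) auto
  moreover have "b * (a / b - 1) = a - b" using \<open>b > 0\<close> by (simp add: field_simps)
  moreover have "b * (ln b - ln a) = - (b * (ln a - ln b))" by (simp add: algebra_simps)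
  ultimately show "0 \<le> R" unfolding R by linarith
  have "ln b - ln a \<le> b / a - 1"
    using ln_le_minus_one[of "b / a"] assms by (simp add: ln_div)
  then have "b * (ln b - ln a) \<le> b * (b / a - 1)"
    using assms by (intro mult_left_mono) auto
  then have "R \<le> b * (b / a - 1) - (b - a)" by (simp add: R)
  also have "\<dots> = (b - a)\<^sup>2 / a"
    using assms by (simp add: field_simps power2_eq_square)
  finally show "R \<le> (b - a)\<^sup>2 / a" .
qed

lemma bounded_compactly_supported:
  fixes f :: "'n::finite fn"
  assumes "continuous_on UNIV f" "compactly_supported f"
  obtains M where "M > 0" "\<And>x. \<bar>f x\<bar> \<le> M"
proof -
  let ?K = "closure {x. f x \<noteq> 0}"
  have "compact (f ` ?K)"
    using assms continuous_on_subset by (intro compact_continuous_image) (auto simp: compactly_supported_def)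
  then obtain M where M: "M > 0" "\<forall>y\<in>f ` ?K. norm y \<le> M"
    using compact_imp_bounded bounded_pos by blast
  have "\<bar>f x\<bar> \<le> M" for x
    using M closure_subset[of "{x. f x \<noteq> 0}"] by (cases "f x = 0") auto
  then show ?thesis using M(1) that by blast
qed

text \<open>With \<open>b = \<rho> + \<epsilon> g\<close> and \<open>a = \<rho>\<close> the pointwise remainder lies between \<open>0\<close> and \<open>\<epsilon>\<^sup>2 g\<^sup>2 / \<rho>\<close>, which is continuous
  with compact support. Hence the first order expansion holds up to an error \<open>C \<epsilon>\<^sup>2\<close>, with no
  differentiation under the integral sign.\<close>

lemma rel_entropy_derivative:
  fixes \<rho> \<mu> :: "'n::finite fn"
  assumes c: "continuous_on UNIV \<rho>" "continuous_on UNIV \<mu>"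
    and pos: "\<And>x. \<rho> x > 0" "\<And>x. \<mu> x > 0"
    and int: "integrable lborel (\<lambda>x. ln (\<rho> x / \<mu> x) * \<rho> x)"
  shows "has_functional_derivative (rel_entropy \<mu>) \<rho> (d_rel_entropy \<mu> \<rho>)"
  unfolding has_functional_derivative_def
proof (intro ballI conjI)
  fix g :: "'n fn" assume "g \<in> test_functions"
  note g = test_functionsD[OF this]
  have [measurable]: "\<rho> \<in> borel_measurable borel" "\<mu> \<in> borel_measurable borel" "g \<in> borel_measurable borel"
    using c g(1) by (auto intro: borel_measurable_continuous_onI)
  let ?\<xi> = "d_rel_entropy \<mu> \<rho>"
  have nz: "\<rho> x \<noteq> 0" "\<mu> x \<noteq> 0" for x using pos[of x] by auto
  have c\<xi>: "continuous_on UNIV ?\<xi>"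
    unfolding d_rel_entropy_def using c nz by (intro continuous_intros) auto
  have ig: "integrable lborel (\<lambda>x. u x * g x)" if "continuous_on UNIV u" for u
    using that g by (intro integrable_compactly_supported compactly_supported_mult[OF disjI2] continuous_on_mult)
  have i\<xi>: "integrable lborel (\<lambda>x. ?\<xi> x * g x)" by (rule ig[OF c\<xi>])
  then show "pairable (\<lambda>_. 1) ?\<xi> g" by (simp add: pairable_def)
  have cq: "continuous_on UNIV (\<lambda>x. g x / \<rho> x)"
    using c g nz by (intro continuous_intros) auto
  have iq: "integrable lborel (\<lambda>x. g x / \<rho> x * g x)" by (rule ig[OF cq])
  have sq: "compactly_supported (\<lambda>x. g x / \<rho> x)"
    using compactly_supported_mult[of g "\<lambda>x. 1 / \<rho> x"] g(2) by simp
  \<comment> \<open>For \<open>\<bar>\<epsilon>\<bar> < 1 / M\<close> the perturbed density \<open>\<rho> + \<epsilon> g\<close> stays positive.\<close>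
  obtain M where M: "M > 0" "\<And>x. \<bar>g x / \<rho> x\<bar> \<le> M"
    using bounded_compactly_supported[OF cq sq] by blast
  define C where "C = (\<integral>x. g x / \<rho> x * g x \<partial>lborel)"
  define I where "I = inner_w (\<lambda>_. 1) ?\<xi> g"
  have I: "I = (\<integral>x. ?\<xi> x * g x \<partial>lborel)" by (simp add: I_def inner_w_def)
  let ?S = "\<lambda>\<epsilon>. rel_entropy \<mu> (\<lambda>x. \<rho> x + \<epsilon> * g x)"
  have bound: "\<bar>?S \<epsilon> - ?S 0 - \<epsilon> * I\<bar> \<le> \<epsilon>\<^sup>2 * C" if \<epsilon>: "\<bar>\<epsilon>\<bar> < 1 / M" for \<epsilon>
  proof -
    define R where "R x = ln ((\<rho> x + \<epsilon> * g x) / \<mu> x) * (\<rho> x + \<epsilon> * g x) - ln (\<rho> x / \<mu> x) * \<rho> x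
      - ?\<xi> x * (\<epsilon> * g x)" for x
    have p: "\<rho> x + \<epsilon> * g x > 0" for x
    proof -
      have "\<bar>\<epsilon> * (g x / \<rho> x)\<bar> \<le> \<bar>\<epsilon>\<bar> * M"
        unfolding abs_mult using M(2) by (intro mult_left_mono) auto
      also have "\<dots> < 1" using \<epsilon> M(1) by (simp add: field_simps)
      finally have "0 < 1 + \<epsilon> * (g x / \<rho> x)" by linarith
      then have "0 < \<rho> x * (1 + \<epsilon> * (g x / \<rho> x))"
        using pos(1)[of x] by (rule mult_pos_pos[rotated])
      then show ?thesis using nz(1)[of x] by (simp add: distrib_left)
    qed
    have R: "0 \<le> R x" "R x \<le> \<epsilon>\<^sup>2 * (g x / \<rho> x * g x)" for x
      using entropy_remainder[OF pos(1)[of x] p[of x] pos(2)[of x]]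
      by (simp_all add: R_def d_rel_entropy_def power2_eq_square mult_ac)
    have [measurable]: "R \<in> borel_measurable lborel"
      unfolding R_def[abs_def] d_rel_entropy_def by measurable
    have iR: "integrable lborel R"
      by (rule Bochner_Integration.integrable_bound[OF integrable_mult_right[OF iq, of "\<epsilon>\<^sup>2"]])
         (simp_all only: real_norm_def abs_of_nonneg[OF R(1)] AE_I2 order_trans[OF R(2) abs_ge_self] \<open>R \<in> borel_measurable lborel\<close>)
    have "?S \<epsilon> = (\<integral>x. R x + ln (\<rho> x / \<mu> x) * \<rho> x + \<epsilon> * (?\<xi> x * g x) \<partial>lborel)"
      unfolding rel_entropy_def R_def by (simp add: algebra_simps)
    also have "\<dots> = (\<integral>x. R x \<partial>lborel) + ?S 0 + \<epsilon> * I"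
      unfolding I rel_entropy_def using iR int i\<xi> by simp
    finally have "?S \<epsilon> - ?S 0 - \<epsilon> * I = (\<integral>x. R x \<partial>lborel)" by simp
    moreover have "0 \<le> (\<integral>x. R x \<partial>lborel)" using R by simp
    moreover have "(\<integral>x. R x \<partial>lborel) \<le> (\<integral>x. \<epsilon>\<^sup>2 * (g x / \<rho> x * g x) \<partial>lborel)"
      by (rule integral_mono[OF iR integrable_mult_right[OF iq]]) (use R in auto)
    moreover have "(\<integral>x. \<epsilon>\<^sup>2 * (g x / \<rho> x * g x) \<partial>lborel) = \<epsilon>\<^sup>2 * C"
      unfolding C_def by (rule integral_mult_right_zero)
    ultimately show ?thesis by simp
  qed
  have "((\<lambda>\<epsilon>. (?S \<epsilon> - ?S 0) / \<epsilon> - I) \<longlongrightarrow> 0) (at 0)"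
  proof (rule Lim_null_comparison)
    show "\<forall>\<^sub>F \<epsilon> in at 0. norm ((?S \<epsilon> - ?S 0) / \<epsilon> - I) \<le> \<bar>\<epsilon>\<bar> * C"
      unfolding eventually_at
    proof (intro exI[of _ "1 / M"] conjI ballI impI)
      fix \<epsilon> :: real assume e: "\<epsilon> \<noteq> 0 \<and> dist \<epsilon> 0 < 1 / M"
      have "norm ((?S \<epsilon> - ?S 0) / \<epsilon> - I) = \<bar>?S \<epsilon> - ?S 0 - \<epsilon> * I\<bar> / \<bar>\<epsilon>\<bar>"
        using e by (simp add: abs_divide[symmetric] diff_divide_distrib)
      also have "\<dots> \<le> \<epsilon>\<^sup>2 * C / \<bar>\<epsilon>\<bar>"
        using e by (intro divide_right_mono bound) auto
      also have "\<dots> = \<bar>\<epsilon>\<bar> * C"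
        using e by (simp add: power2_eq_square field_simps abs_mult_self_eq)
      finally show "norm ((?S \<epsilon> - ?S 0) / \<epsilon> - I) \<le> \<bar>\<epsilon>\<bar> * C" .
    qed (use M in auto)
    show "((\<lambda>\<epsilon>::real. \<bar>\<epsilon>\<bar> * C) \<longlongrightarrow> 0) (at 0)"
      by (rule tendsto_eq_intros refl | simp)+
  qed
  then have "((\<lambda>\<epsilon>. (?S \<epsilon> - ?S 0) / \<epsilon>) \<longlongrightarrow> I) (at 0)"
    by (simp add: LIM_zero_iff)
  then show "(?S has_real_derivative inner_w (\<lambda>_. 1) ?\<xi> g) (at 0)"
    by (simp add: DERIV_def I_def)
qed

section \<open>The generator in linear hypocoercive form\<close>

lemma adjoint_on_mono: "adjoint_on w P T T' \<Longrightarrow> Q \<subseteq> P \<Longrightarrow> adjoint_on w Q T T'"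
  unfolding adjoint_on_def by blast

lemma hypocoerciveD:
  assumes "linear_hypocoercive_form D V \<mu> L B A Astar"
  shows "f \<in> D \<Longrightarrow> L f x = B f x - sum_AstarA A Astar f x"
    "acts_on D (A i)" "acts_on D (Astar i)" "linear_opr D (A i)" "chain_rule D (A i)"
    "adjoint_on \<mu> (test_pairs D) (A i) (Astar i)"
    "acts_on D B" "linear_opr D B" "chain_rule D B" "product_rule D B"
    "adjoint_on \<mu> (test_pairs D) B (\<lambda>g x. - B g x)"
  using assms unfolding linear_hypocoercive_form_def
  by (auto intro: adjoint_on_mono[of _ "test_pairs D \<union> V \<times> V"])

lemma sum_in_domain:
  assumes D: "calculus_domain D" and "finite I" "\<And>i. i \<in> I \<Longrightarrow> f i \<in> D"
  shows "(\<lambda>x. \<Sum>i\<in>I. f i x) \<in> D"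
  using assms(2,3) by (induction I rule: finite_induct) (auto intro: calculus_domainD(3,4)[OF D])

text \<open>Two integrations by parts in \<open>L\<^sup>2\<^sub>\<mu>\<close> move \<open>A\<^sup>* A\<close> from the test function to \<open>h\<close>. The first of them pairs \<open>h\<close>
  with \<open>A\<^sub>i \<phi>\<close>, whence the need for compact support of \<open>A\<^sub>i \<phi>\<close>.\<close>

lemma generator_adjoint_weight:
  assumes D: "calculus_domain D" "\<mu> \<in> D"
    and hyp: "linear_hypocoercive_form D V \<mu> L B A Astar"
    and adj: "adjoint_on (\<lambda>_. 1) (test_pairs D) L L'" and acts: "acts_on D L'"
    and h: "h \<in> D"
  shows "L' (\<lambda>x. \<mu> x * h x) = (\<lambda>x. \<mu> x * (- 1 * (B h x + sum_AstarA A Astar h x)))"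
proof (rule formal_adjoint_eqI[OF D(1) adj acts])
  note H = hypocoerciveD[OF hyp]
  have mem: "A i f \<in> D" "Astar i f \<in> D" "B f \<in> D" if "f \<in> D" for f i
    using that H(2,3,7) by (auto simp: acts_on_def)
  have "(\<lambda>x. B h x + sum_AstarA A Astar h x) \<in> D"
    unfolding sum_AstarA_def using h mem
    by (intro calculus_domainD(4)[OF D(1)] sum_in_domain[OF D(1)]) auto
  from calculus_domainD(6)[OF D(1) this, of "-1"]
  show "(\<lambda>x. \<mu> x * h x) \<in> D" "(\<lambda>x. \<mu> x * (- 1 * (B h x + sum_AstarA A Astar h x))) \<in> D"
    using D h calculus_domainD(5)[OF D(1)] by auto
  fix \<phi> :: "'a fn" assume \<phi>: "\<phi> \<in> test_functions"
  have \<phi>D: "\<phi> \<in> D" using \<phi> calculus_domainD(2)[OF D(1)] by blast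
  have cs: "compactly_supported (A i \<phi>)" for i
    using derivation_compactly_supported[OF D(1) chain_rule_imp_product_rule[OF D(1) H(4,5)] \<phi>D]
      test_functionsD(2)[OF \<phi>] by blast
  have A: "integrable lborel (\<lambda>x. Astar i (A i \<phi>) x * h x * \<mu> x)"
    "integrable lborel (\<lambda>x. \<phi> x * Astar i (A i h) x * \<mu> x)"
    "(\<integral>x. Astar i (A i \<phi>) x * h x * \<mu> x \<partial>lborel) = (\<integral>x. \<phi> x * Astar i (A i h) x * \<mu> x \<partial>lborel)" for i
  proof -
    have "(h, A i \<phi>) \<in> test_pairs D"
      using h mem \<phi>D cs by (simp add: test_pairs_def)
    note 1 = adjoint_onD[OF H(6)[of i] this]
    have sym: "A i h x * A i \<phi> x * \<mu> x = A i \<phi> x * A i h x * \<mu> x" for x by simp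
    note 2 = adjoint_onD[OF H(6)[of i] test_pair[OF D(1) \<phi> mem(1)[OF h]]]
    show "integrable lborel (\<lambda>x. Astar i (A i \<phi>) x * h x * \<mu> x)"
      "integrable lborel (\<lambda>x. \<phi> x * Astar i (A i h) x * \<mu> x)"
      "(\<integral>x. Astar i (A i \<phi>) x * h x * \<mu> x \<partial>lborel) = (\<integral>x. \<phi> x * Astar i (A i h) x * \<mu> x \<partial>lborel)"
      using 1[unfolded sym] 2[of i] by (simp_all add: mult.commute[of "h _"])
  qed
  note B = adjoint_onD[OF H(11) test_pair[OF D(1) \<phi> h]]
  have "(\<integral>x. L \<phi> x * (\<mu> x * h x) \<partial>lborel)
      = (\<integral>x. B \<phi> x * h x * \<mu> x - (\<Sum>i\<in>UNIV. Astar i (A i \<phi>) x * h x * \<mu> x) \<partial>lborel)"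
    by (simp add: H(1)[OF \<phi>D] sum_AstarA_def right_diff_distrib sum_distrib_left mult_ac)
  also have "\<dots> = (\<integral>x. \<phi> x * - B h x * \<mu> x - (\<Sum>i\<in>UNIV. \<phi> x * Astar i (A i h) x * \<mu> x) \<partial>lborel)"
    using A B by (simp add: Bochner_Integration.integral_diff Bochner_Integration.integral_sum
        Bochner_Integration.integrable_sum del: mult_minus_right mult_minus_left)
  also have "\<dots> = (\<integral>x. \<phi> x * (\<mu> x * (- 1 * (B h x + sum_AstarA A Astar h x))) \<partial>lborel)"
    by (simp add: sum_AstarA_def algebra_simps sum_distrib_left sum_negf)
  finally show "(\<integral>x. L \<phi> x * (\<mu> x * h x) \<partial>lborel) =
      (\<integral>x. \<phi> x * (\<mu> x * (- 1 * (B h x + sum_AstarA A Astar h x))) \<partial>lborel)" .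
qed

text \<open>Evaluating \<open>0 = B' 1 = B' (\<mu> (1 / \<mu>)) = - \<mu> B (1 / \<mu>) = B \<mu> / \<mu>\<close>.\<close>

lemma antisymmetric_derivation_kills_weight:
  assumes D: "calculus_domain D" "\<mu> \<in> D" and pos: "\<And>x. \<mu> x > 0"
    and B: "chain_rule D B" "acts_on D B" "adjoint_on \<mu> (test_pairs D) B (\<lambda>g x. - B g x)"
    and B': "product_rule D B'" "acts_on D B'" "adjoint_on (\<lambda>_. 1) (test_pairs D) B B'"
  shows "B \<mu> x = 0"
proof -
  have inv: "(\<lambda>x. inverse (\<mu> x)) \<in> D"
    using pos by (intro calculus_domainD(7)[OF D(1,2), of "{0<..}"] smooth_inverse) auto
  have neg: "acts_on D (\<lambda>g x. - B g x)"
    using B(2) calculus_domainD(6)[OF D(1), of _ "-1"] by (simp add: acts_on_def)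
  have nz: "\<mu> x \<noteq> 0" for x using pos[of x] by simp
  have "0 = B' (\<lambda>x. \<mu> x * inverse (\<mu> x)) x"
    using derivation_one[OF D(1) B'(1)] nz by simp
  also have "\<dots> = - \<mu> x * B (\<lambda>x. inverse (\<mu> x)) x"
    by (simp add: formal_adjoint_weight[OF D B'(3) B(3) B'(2) neg inv])
  also have "B (\<lambda>x. inverse (\<mu> x)) x = deriv inverse (\<mu> x) * B \<mu> x"
    by (rule chain_ruleD[OF B(1) D(2), of "{0<..}"]) (use pos smooth_inverse in auto)
  also have "deriv inverse (\<mu> x) = - (inverse (\<mu> x) * inverse (\<mu> x))"
    using DERIV_imp_deriv[OF DERIV_inverse[OF nz[of x]]] by (simp add: numeral_2_eq_2)
  finally show ?thesis using nz[of x] by simp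
qed

lemma density_ratio:
  assumes D: "calculus_domain D" "\<mu> \<in> D" and pos: "\<And>x. \<mu> x > 0" and \<rho>: "\<rho> \<in> positive_in D"
  shows "(\<lambda>x. \<rho> x / \<mu> x) \<in> D" "\<And>x. 0 < \<rho> x / \<mu> x" "(\<lambda>x. ln (\<rho> x / \<mu> x)) \<in> D"
    "(\<lambda>x. \<mu> x * (\<rho> x / \<mu> x)) = \<rho>"
proof -
  have "(\<lambda>x. inverse (\<mu> x)) \<in> D"
    using pos by (intro calculus_domainD(7)[OF D, of "{0<..}"] smooth_inverse) auto
  then show h: "(\<lambda>x. \<rho> x / \<mu> x) \<in> D"
    using \<rho> calculus_domainD(5)[OF D(1), of \<rho>] by (simp add: positive_in_def divide_inverse)
  show p: "0 < \<rho> x / \<mu> x" for x using pos \<rho> by (simp add: positive_in_def)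
  show "(\<lambda>x. ln (\<rho> x / \<mu> x)) \<in> D"
    using p by (intro calculus_domainD(7)[OF D(1) h, of "{0<..}"] smooth_ln) auto
  show "(\<lambda>x. \<mu> x * (\<rho> x / \<mu> x)) = \<rho>"
    using pos by (simp add: fun_eq_iff less_imp_neq[symmetric])
qed

lemma chain_rule_ln_ratio:
  assumes D: "calculus_domain D" "\<mu> \<in> D" and pos: "\<And>x. \<mu> x > 0" and \<rho>: "\<rho> \<in> positive_in D"
    and T: "chain_rule D T"
  shows "\<rho> x * T (\<lambda>x. ln (\<rho> x / \<mu> x)) x = \<mu> x * T (\<lambda>x. \<rho> x / \<mu> x) x"
proof -
  note h = density_ratio[OF D pos \<rho>]
  have "T (\<lambda>x. ln (\<rho> x / \<mu> x)) x = deriv ln (\<rho> x / \<mu> x) * T (\<lambda>x. \<rho> x / \<mu> x) x"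
    by (rule chain_ruleD[OF T h(1), of "{0<..}"]) (use h(2) smooth_ln in auto)
  also have "deriv ln (\<rho> x / \<mu> x) = inverse (\<rho> x / \<mu> x)"
    by (rule DERIV_imp_deriv[OF DERIV_ln[OF h(2)]])
  finally show ?thesis using \<rho> by (simp add: positive_in_def less_imp_neq[symmetric])
qed

text \<open>The constant in \<open>\<^bold>d S\<close> is killed by \<open>A\<^sub>i\<close>, and \<open>\<rho> A\<^sub>i (ln (\<rho> / \<mu>)) = \<mu> A\<^sub>i (\<rho> / \<mu>)\<close>; the factors \<open>2\<close> and \<open>1/2\<close>
  cancel.\<close>

lemma wasserstein_opr_d_rel_entropy:
  assumes D: "calculus_domain D" "\<mu> \<in> D" and pos: "\<And>x. \<mu> x > 0"
    and hyp: "linear_hypocoercive_form D V \<mu> L B A Astar"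
    and adj: "\<And>i. adjoint_on (\<lambda>_. 1) (test_pairs D) (A i) (A' i)" and acts: "\<And>i. acts_on D (A' i)"
    and \<rho>: "\<rho> \<in> positive_in D"
  shows "wasserstein_opr A A' \<rho> (\<lambda>y. 1/2 * d_rel_entropy \<mu> \<rho> y) x
    = \<mu> x * sum_AstarA A Astar (\<lambda>x. \<rho> x / \<mu> x) x"
proof -
  note H = hypocoerciveD[OF hyp]
  note h = density_ratio[OF D pos \<rho>]
  have term_eq: "A' i (\<lambda>y. \<rho> y * A i (\<lambda>y. 1/2 * d_rel_entropy \<mu> \<rho> y) y) x
      = 1/2 * (\<mu> x * Astar i (A i (\<lambda>x. \<rho> x / \<mu> x)) x)" for i
  proof -
    have pr: "product_rule D (A i)" by (rule chain_rule_imp_product_rule[OF D(1) H(4,5)])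
    have "A i (\<lambda>y. 1/2 * (ln (\<rho> y / \<mu> y) + 1)) y = 1/2 * (A i (\<lambda>y. ln (\<rho> y / \<mu> y)) y + A i (\<lambda>_. 1) y)" for y
      using h(3) calculus_domainD(3)[OF D(1), of 1]
      by (simp only: linear_oprD[OF H(4)] calculus_domainD(4)[OF D(1)])
    then have "(\<lambda>y. \<rho> y * A i (\<lambda>y. 1/2 * d_rel_entropy \<mu> \<rho> y) y)
        = (\<lambda>y. 1/2 * (\<mu> y * A i (\<lambda>x. \<rho> x / \<mu> x) y))"
      by (simp only: d_rel_entropy_def derivation_one[OF D(1) pr] add_0_right
          mult.left_commute[of _ "1/2"] chain_rule_ln_ratio[OF D pos \<rho> H(5)])
    moreover have m: "A i (\<lambda>x. \<rho> x / \<mu> x) \<in> D" using H(2)[of i] h(1) by (simp add: acts_on_def)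
    ultimately show ?thesis
      by (simp only: formal_adjoint_scale[OF D(1) adj acts calculus_domainD(5)[OF D m]]
          formal_adjoint_weight[OF D adj H(6) acts H(3) m])
  qed
  show ?thesis
    unfolding wasserstein_opr_def term_eq sum_AstarA_def sum_distrib_left by simp
qed

lemma fokker_planck_GENERIC:
  assumes D: "calculus_domain D" "\<mu> \<in> D" and pos: "\<And>x. \<mu> x > 0"
    and hyp: "linear_hypocoercive_form D V \<mu> L B A Astar"
    and adj_L: "adjoint_on (\<lambda>_. 1) (test_pairs D) L L'" "acts_on D L'"
    and adj: "\<And>i. adjoint_on (\<lambda>_. 1) (test_pairs D) (A i) (A' i)" "\<And>i. acts_on D (A' i)"
    and B': "product_rule D B'" "acts_on D B'" "adjoint_on (\<lambda>_. 1) (test_pairs D) B B'"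
    and \<rho>: "\<rho> \<in> positive_in D"
  shows "L' \<rho> = (\<lambda>x. - B \<rho> x - wasserstein_opr A A' \<rho> (\<lambda>y. 1/2 * d_rel_entropy \<mu> \<rho> y) x)"
proof
  fix x
  note H = hypocoerciveD[OF hyp]
  note h = density_ratio[OF D pos \<rho>]
  have "B \<rho> x = \<mu> x * B (\<lambda>x. \<rho> x / \<mu> x) x"
    using product_ruleD[OF H(10) D(2) h(1), of x]
      antisymmetric_derivation_kills_weight[OF D pos H(9,7,11) B', of x]
    unfolding h(4) by simp
  then show "L' \<rho> x = - B \<rho> x - wasserstein_opr A A' \<rho> (\<lambda>y. 1/2 * d_rel_entropy \<mu> \<rho> y) x"
    using generator_adjoint_weight[OF D hyp adj_L h(1)]
    unfolding h(4) wasserstein_opr_d_rel_entropy[OF D pos hyp adj \<rho>]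
    by (simp add: algebra_simps)
qed

section \<open>Symmetry, positivity and degeneracy\<close>

text \<open>Duality turns the form into \<open>2 \<Sum>\<^sub>i \<integral> \<rho> A\<^sub>i \<xi> A\<^sub>i \<eta>\<close>. It is enough to have the duality for fluxes \<open>\<rho> A\<^sub>i \<eta>\<close>, for
  which it comes either from compact support or from an assumption on the class of densities.\<close>

lemma symmetric_psd_wasserstein_opr:
  assumes adj: "\<And>i \<xi> \<eta>. \<xi> \<in> E \<Longrightarrow> \<eta> \<in> E \<Longrightarrow>
      adjoint_on (\<lambda>_. 1) {(\<xi>, \<lambda>x. \<rho> x * A i \<eta> x)} (A i) (A' i)"
    and \<rho>: "\<And>x. 0 \<le> \<rho> x"
  shows "symmetric_psd E (wasserstein_opr A A' \<rho>)"
proof -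
  have pair: "integrable lborel (\<lambda>x. wasserstein_opr A A' \<rho> \<xi> x * \<eta> x)"
    "(\<integral>x. wasserstein_opr A A' \<rho> \<xi> x * \<eta> x \<partial>lborel) = 2 * (\<Sum>i\<in>UNIV. \<integral>x. \<rho> x * A i \<xi> x * A i \<eta> x \<partial>lborel)"
    if "\<xi> \<in> E" "\<eta> \<in> E" for \<xi> \<eta>
  proof -
    have a: "integrable lborel (\<lambda>x. \<eta> x * A' i (\<lambda>y. \<rho> y * A i \<xi> y) x)"
      "(\<integral>x. \<eta> x * A' i (\<lambda>y. \<rho> y * A i \<xi> y) x \<partial>lborel) = (\<integral>x. \<rho> x * A i \<xi> x * A i \<eta> x \<partial>lborel)" for i
      using adjoint_onD[OF adj[OF that(2,1), of i]] by (auto simp: mult_ac)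
    have eq: "(\<lambda>x. wasserstein_opr A A' \<rho> \<xi> x * \<eta> x)
        = (\<lambda>x. 2 * (\<Sum>i\<in>UNIV. \<eta> x * A' i (\<lambda>y. \<rho> y * A i \<xi> y) x))"
      by (simp add: wasserstein_opr_def sum_distrib_left mult_ac)
    show "integrable lborel (\<lambda>x. wasserstein_opr A A' \<rho> \<xi> x * \<eta> x)"
      unfolding eq by (intro integrable_mult_right Bochner_Integration.integrable_sum a)
    show "(\<integral>x. wasserstein_opr A A' \<rho> \<xi> x * \<eta> x \<partial>lborel) = 2 * (\<Sum>i\<in>UNIV. \<integral>x. \<rho> x * A i \<xi> x * A i \<eta> x \<partial>lborel)"
      unfolding eq using a by simp
  qed
  show ?thesis
    unfolding symmetric_psd_def pairable_def inner_w_def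
  proof (intro conjI ballI)
    fix \<xi> \<eta> assume m: "\<xi> \<in> E" "\<eta> \<in> E"
    show "integrable lborel (\<lambda>x. wasserstein_opr A A' \<rho> \<xi> x * \<eta> x * 1)"
      using pair(1)[OF m] by simp
    show "(\<integral>x. wasserstein_opr A A' \<rho> \<xi> x * \<eta> x * 1 \<partial>lborel) = (\<integral>x. \<xi> x * wasserstein_opr A A' \<rho> \<eta> x * 1 \<partial>lborel)"
      using pair(2)[OF m] pair(2)[OF m(2,1)] by (simp add: mult_ac)
  next
    fix \<xi> assume m: "\<xi> \<in> E"
    have "0 \<le> (\<integral>x. \<rho> x * A i \<xi> x * A i \<xi> x \<partial>lborel)" for i
      using \<rho> by (intro integral_nonneg_AE AE_I2) (simp add: mult.assoc)
    then show "0 \<le> (\<integral>x. wasserstein_opr A A' \<rho> \<xi> x * \<xi> x * 1 \<partial>lborel)"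
      using pair(2)[OF m m] by (simp add: sum_nonneg)
  qed
qed

text \<open>The drift conserves mass (\<open>\<integral> B \<rho> = (\<rho>, B' 1) = 0\<close>), and \<open>\<rho> B' (ln (\<rho> / \<mu>)) = \<mu> B' (\<rho> / \<mu>) = B' \<rho> = - B \<rho>\<close>
  reduces the entropy production of the drift to its change of mass.\<close>

lemma degeneracy:
  assumes D: "calculus_domain D" "\<mu> \<in> D" and pos: "\<And>x. \<mu> x > 0"
    and B: "chain_rule D B" "product_rule D B" "acts_on D B"
      "adjoint_on \<mu> (test_pairs D) B (\<lambda>g x. - B g x)"
    and B': "chain_rule D B'" "product_rule D B'" "acts_on D B'" "adjoint_on (\<lambda>_. 1) (test_pairs D) B B'"
    and adj: "adjoint_on (\<lambda>_. 1) {(\<rho>, \<lambda>_. 1), (\<rho>, \<lambda>x. ln (\<rho> x / \<mu> x))} B B'"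
    and \<rho>: "\<rho> \<in> positive_in D"
  shows "pairable (\<lambda>_. 1) (\<lambda>x. - B \<rho> x) (d_rel_entropy \<mu> \<rho>) \<and>
    inner_w (\<lambda>_. 1) (\<lambda>x. - B \<rho> x) (d_rel_entropy \<mu> \<rho>) = 0"
proof -
  note h = density_ratio[OF D pos \<rho>]
  let ?h = "\<lambda>x. \<rho> x / \<mu> x"
  have B\<rho>: "B \<rho> x = \<mu> x * B ?h x" for x
    using product_ruleD[OF B(2) D(2) h(1), of x]
      antisymmetric_derivation_kills_weight[OF D pos B(1,3,4) B'(2-4), of x]
    unfolding h(4) by simp
  have neg: "acts_on D (\<lambda>g x. - B g x)"
    using B(3) calculus_domainD(6)[OF D(1), of _ "-1"] by (simp add: acts_on_def)
  note one = calculus_domainD(3)[OF D(1), of 1]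
  have B'\<mu>: "B' \<mu> x = 0" for x
    using formal_adjoint_weight[OF D B'(4) B(4) B'(3) neg one] derivation_one[OF D(1) B(2)]
    by simp
  have "B' \<rho> x = - \<mu> x * B ?h x" for x
    using formal_adjoint_weight[OF D B'(4) B(4) B'(3) neg h(1)] unfolding h(4) by simp
  moreover have "B' \<rho> x = \<mu> x * B' ?h x" for x
    using product_ruleD[OF B'(2) D(2) h(1), of x] B'\<mu> unfolding h(4) by simp
  ultimately have ln: "\<rho> x * B' (\<lambda>x. ln (?h x)) x = - B \<rho> x" for x
    using chain_rule_ln_ratio[OF D pos \<rho> B'(1), of x] B\<rho>[of x] by simp
  have 1: "integrable lborel (B \<rho>)" "(\<integral>x. B \<rho> x \<partial>lborel) = 0"
    using adjoint_onD[OF adj, of \<rho> "\<lambda>_. 1"] derivation_one[OF D(1) B'(2)] by simp_all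
  have 2: "integrable lborel (\<lambda>x. B \<rho> x * ln (?h x))" "(\<integral>x. B \<rho> x * ln (?h x) \<partial>lborel) = 0"
    using adjoint_onD[OF adj, of \<rho> "\<lambda>x. ln (?h x)"] ln 1 by simp_all
  have eq: "(\<lambda>x. - B \<rho> x * d_rel_entropy \<mu> \<rho> x * 1) = (\<lambda>x. - (B \<rho> x * ln (?h x) + B \<rho> x))"
    by (simp add: d_rel_entropy_def algebra_simps)
  show ?thesis
    unfolding pairable_def inner_w_def eq using 1 2 by simp
qed

section \<open>The Fokker-Planck equation as a pre-GENERIC system\<close>

theorem mainTheorem1:
  fixes P :: "'w measure"
    and X :: "real \<Rightarrow> 'w \<Rightarrow> real^'n::finite"
    and K :: "real \<Rightarrow> real^'n \<Rightarrow> (real^'n) measure"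
    and \<mu> :: "'n fn"
    and D V :: "'n fn set"
    and L L' B B' :: "'n opr"
    and A A' Astar :: "'n \<Rightarrow> 'n opr"
  assumes process: "markov_process P X K"
    and law_density: "\<And>t. t \<ge> 0 \<Longrightarrow> \<exists>r. distributed P lborel (X t) r"
    and mu_pos: "\<And>x. \<mu> x > 0"
    and mu_invariant: "invariant_measure K (density lborel (\<lambda>x. ennreal (\<mu> x)))"
    and mu_unique: "\<And>m. invariant_measure K m \<Longrightarrow> m = density lborel (\<lambda>x. ennreal (\<mu> x))"
    and semigroup: "contraction_semigroup \<mu> (semigroup_of K)"
    and generator: "\<And>f. f \<in> V \<Longrightarrow> generates \<mu> (semigroup_of K) f (L f)"
    and kernel_generator: "\<And>f. generates \<mu> (semigroup_of K) f (\<lambda>_. 0) \<longleftrightarrow>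
           f \<in> L2 \<mu> \<and> (\<exists>c. AE x in lborel. f x = c)"
    and domain: "calculus_domain D" "\<mu> \<in> D"
    and acts_L: "acts_on D L" "acts_on D L'"
    and adj_L: "adjoint_on (\<lambda>_. 1) (test_pairs D) L L'"
    and mu_stationary: "L' \<mu> = (\<lambda>_. 0)"
    and fp_solvable: "\<exists>\<rho>. positive_classical_solution D L' \<rho>"
    and V_dense: "dense_class D \<mu> (semigroup_of K) L' V"
    and entropy_finite: "\<And>\<rho>. \<rho> \<in> positive_in V \<Longrightarrow>
           integrable lborel (\<lambda>x. ln (\<rho> x / \<mu> x) * \<rho> x)"
    and hypocoercive: "linear_hypocoercive_form D V \<mu> L B A Astar"
    and acts_A': "\<And>i. acts_on D (A' i)"
    and adj_A: "\<And>i. adjoint_on (\<lambda>_. 1)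
           (test_pairs D \<union> {(\<xi>, \<lambda>x. \<rho> x * A i \<eta> x) | \<xi> \<eta> \<rho>. \<xi> \<in> V \<and> \<eta> \<in> V \<and> \<rho> \<in> positive_in V})
           (A i) (A' i)"
    and acts_B': "acts_on D B'"
    and adj_B: "adjoint_on (\<lambda>_. 1)
           (test_pairs D \<union>
            {(\<rho>, g) | \<rho> g. \<rho> \<in> positive_in V \<and> g \<in> {\<lambda>_. 1, \<lambda>x. ln (\<rho> x / \<mu> x)}})
           B B'"
    and B'_rules: "chain_rule D B'" "product_rule D B'"
  shows "wasserstein_pre_GENERIC D V L' (rel_entropy \<mu>) (d_rel_entropy \<mu>)
           (\<lambda>\<rho> x. - B \<rho> x) (wasserstein_opr A A') \<and>
         (\<forall>\<rho>. positive_classical_solution D L' \<rho> \<longrightarrow>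
           solves (\<lambda>r x. - B r x - wasserstein_opr A A' r (\<lambda>y. 1/2 * d_rel_entropy \<mu> r y) x) \<rho> \<and>
           solves (\<lambda>h x. - (B h x + sum_AstarA A Astar h x)) (\<lambda>t x. \<rho> t x / \<mu> x))"
proof -
  let ?T = "test_pairs D"
  note H = hypocoerciveD[OF hypocoercive]
  have VD: "V \<subseteq> D" using V_dense by (simp add: dense_class_def)
  then have pVD: "\<rho> \<in> positive_in D" if "\<rho> \<in> positive_in V" for \<rho>
    using that by (auto simp: positive_in_def)
  have adj_A_test: "adjoint_on (\<lambda>_. 1) ?T (A i) (A' i)" for i
    by (rule adjoint_on_mono[OF adj_A]) simp
  have adj_B_test: "adjoint_on (\<lambda>_. 1) ?T B B'"
    by (rule adjoint_on_mono[OF adj_B]) simp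
  note gen = fokker_planck_GENERIC[OF domain mu_pos hypocoercive adj_L acts_L(2) adj_A_test acts_A'
      B'_rules(2) acts_B' adj_B_test]
  have fd: "has_functional_derivative (rel_entropy \<mu>) \<rho> (d_rel_entropy \<mu> \<rho>)" if "\<rho> \<in> positive_in V" for \<rho>
    using pVD[OF that] domain mu_pos entropy_finite[OF that]
    by (intro rel_entropy_derivative) (auto simp: positive_in_def intro: calculus_domainD(1)[OF domain(1)])
  have psd: "symmetric_psd (V \<union> test_functions) (wasserstein_opr A A' \<rho>)" if \<rho>: "\<rho> \<in> positive_in V" for \<rho>
  proof (rule symmetric_psd_wasserstein_opr)
    show "0 \<le> \<rho> x" for x using \<rho> by (simp add: positive_in_def less_imp_le)
    fix i \<xi> \<eta> assume m: "\<xi> \<in> V \<union> test_functions" "\<eta> \<in> V \<union> test_functions"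
    then have mD: "\<xi> \<in> D" "\<eta> \<in> D" using VD calculus_domainD(2)[OF domain(1)] by auto
    have J: "(\<lambda>x. \<rho> x * A i \<eta> x) \<in> D"
      using pVD[OF \<rho>] mD(2) H(2)[of i] calculus_domainD(5)[OF domain(1)]
      by (simp add: positive_in_def acts_on_def)
    have "(\<xi>, \<lambda>x. \<rho> x * A i \<eta> x) \<in> ?T" if "\<xi> \<in> test_functions \<or> \<eta> \<in> test_functions"
      using that
    proof
      assume "\<xi> \<in> test_functions"
      then show ?thesis by (rule test_pair[OF domain(1) _ J])
    next
      assume "\<eta> \<in> test_functions"
      then have "compactly_supported (A i \<eta>)"
        using derivation_compactly_supported[OF domain(1)
            chain_rule_imp_product_rule[OF domain(1) H(4,5)] mD(2)] test_functionsD(2) by blast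
      then show ?thesis
        using compactly_supported_mult mD J by (auto simp: test_pairs_def)
    qed
    then show "adjoint_on (\<lambda>_. 1) {(\<xi>, \<lambda>x. \<rho> x * A i \<eta> x)} (A i) (A' i)"
      using m \<rho> by (intro adjoint_on_mono[OF adj_A]) auto
  qed
  have deg: "pairable (\<lambda>_. 1) (\<lambda>x. - B \<rho> x) (d_rel_entropy \<mu> \<rho>) \<and>
      inner_w (\<lambda>_. 1) (\<lambda>x. - B \<rho> x) (d_rel_entropy \<mu> \<rho>) = 0" if "\<rho> \<in> positive_in V" for \<rho>
    by (rule degeneracy[OF domain mu_pos H(9,10,7,11) B'_rules acts_B' adj_B_test _ pVD[OF that]],
        rule adjoint_on_mono[OF adj_B]) (use that in auto)
  have "wasserstein_pre_GENERIC D V L' (rel_entropy \<mu>) (d_rel_entropy \<mu>)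
      (\<lambda>\<rho> x. - B \<rho> x) (wasserstein_opr A A')"
    unfolding wasserstein_pre_GENERIC_def quadratic_pre_GENERIC_def
    using fd gen psd deg adj_A_test by blast
  moreover have "solves (\<lambda>r x. - B r x - wasserstein_opr A A' r (\<lambda>y. 1/2 * d_rel_entropy \<mu> r y) x) \<rho>"
    "solves (\<lambda>h x. - (B h x + sum_AstarA A Astar h x)) (\<lambda>t x. \<rho> t x / \<mu> x)"
    if sol: "positive_classical_solution D L' \<rho>" for \<rho>
  proof -
    have \<rho>: "\<rho> t \<in> positive_in D" "((\<lambda>s. \<rho> s x) has_real_derivative L' (\<rho> t) x) (at t)"
      if "t > 0" for t x
      using sol that by (auto simp: positive_classical_solution_def solves_def)
    show "solves (\<lambda>r x. - B r x - wasserstein_opr A A' r (\<lambda>y. 1/2 * d_rel_entropy \<mu> r y) x) \<rho>"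
      unfolding solves_def using \<rho>(2) gen[OF \<rho>(1)] by metis
    show "solves (\<lambda>h x. - (B h x + sum_AstarA A Astar h x)) (\<lambda>t x. \<rho> t x / \<mu> x)"
      unfolding solves_def
    proof (intro allI impI)
      fix t :: real and x assume t: "t > 0"
      note h = density_ratio[OF domain mu_pos \<rho>(1)[OF t]]
      have "L' (\<rho> t) x / \<mu> x = - (B (\<lambda>x. \<rho> t x / \<mu> x) x + sum_AstarA A Astar (\<lambda>x. \<rho> t x / \<mu> x) x)"
        using generator_adjoint_weight[OF domain hypocoercive adj_L acts_L(2) h(1)] mu_pos[of x]
        unfolding h(4) by simp
      with DERIV_cdivide[OF \<rho>(2)[OF t, of x], of "\<mu> x"]
      show "((\<lambda>s. \<rho> s x / \<mu> x) has_real_derivative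
          - (B (\<lambda>x. \<rho> t x / \<mu> x) x + sum_AstarA A Astar (\<lambda>x. \<rho> t x / \<mu> x) x)) (at t)"
        by simp
    qed
  qed
  ultimately show ?thesis by blast
qed

end
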